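(* Let $\phi:[0,\infty)\to\mathbb{R}^+$ be a $C^\infty$-function such that $\phi'$ is positive on $[0,+\infty)$, $\lim_{r\to\infty}\phi(r)=\lim_{r\to\infty}\phi'(r)=+\infty$, and $$\lim_{r\to\infty}\frac{\phi^{(n)}(r)}{\left(\phi'(r)\right)^n}=0\quad\text{for every integer } n\ge2.$$ Write $\phi(z)=\phi(|z|)$ for $z\in\mathbb{C}$. Then, for $0<p<\infty$, the Bergman projection $P_\phi$ is bounded from $L^p(\mathbb{C},e^{-2\phi})$ to $L^p(\mathbb{C},e^{-2\phi})$ only for $p=2$.
   Context: $\mathbb{R}^+=[0,\infty)$ and $dm(z)=\frac{dx\,dy}{\pi}$ is area measure on $\mathbb{C}$. $L^p(\mathbb{C},e^{-2\phi})$ is the space of measurable $f$ on $\mathbb{C}$ with $\|f\|^p_{L^p(\mathbb{C},e^{-2\phi})}=\int_{\mathbb{C}}|f|^pe^{-2\phi}\,dm<\infty$. The Fock space $\mathcal{F}^\phi_2$ is the (closed) subspace of entire functions in $L^2(\mathbb{C},e^{-2\phi})$, with reproducing kernel $K_a$ at $a\in\mathbb{C}$. The Bergman projection $P_\phi$ is the orthogonal projection of $L^2(\mathbb{C},e^{-2\phi})$ onto $\mathcal{F}^\phi_2$, given by $P_\phi f(a)=\int_{\mathbb{C}}f(z)\overline{K_a(z)}e^{-2\phi(z)}\,dm(z)$. $P_\phi$ being bounded from $L^p(\mathbb{C},e^{-2\phi})$ to $L^p(\mathbb{C},e^{-2\phi})$ means that there is a constant $C$ with $\|P_\phi f\|_{L^p(\mathbb{C},e^{-2\phi})}\le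 C\|f\|_{L^p(\mathbb{C},e^{-2\phi})}$ for all $f\in L^2(\mathbb{C},e^{-2\phi})\cap L^p(\mathbb{C},e^{-2\phi})$. *)

theory Defs
  imports "HOL-Analysis.Analysis"
begin

definition area_measure :: "complex measure" where
  "area_measure = density lborel (\<lambda>_. ennreal (1 / pi))"

text \<open>The weight is \<open>exp (- 2 * \<psi> z)\<close> for every exponent \<open>p\<close>. Functions are not identified when
  they agree almost everywhere.\<close>

definition weighted_Lp :: "real \<Rightarrow> (complex \<Rightarrow> real) \<Rightarrow> (complex \<Rightarrow> complex) set" where
  "weighted_Lp p \<psi> =
     {f. f \<in> borel_measurable area_measure \<and>
         integrable area_measure (\<lambda>z. cmod (f z) powr p * exp (- 2 * \<psi> z))}"

definition weighted_Lp_norm :: "real \<Rightarrow> (complex \<Rightarrow> real) \<Rightarrow> (complex \<Rightarrow> complex) \<Rightarrow> real" where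
  "weighted_Lp_norm p \<psi> f =
     (LINT z|area_measure. cmod (f z) powr p * exp (- 2 * \<psi> z)) powr (1 / p)"

definition weighted_inner ::
    "(complex \<Rightarrow> real) \<Rightarrow> (complex \<Rightarrow> complex) \<Rightarrow> (complex \<Rightarrow> complex) \<Rightarrow> complex" where
  "weighted_inner \<psi> f g =
     (LINT z|area_measure. f z * cnj (g z) * of_real (exp (- 2 * \<psi> z)))"

definition fock_space :: "(complex \<Rightarrow> real) \<Rightarrow> (complex \<Rightarrow> complex) set" where
  "fock_space \<psi> = {f. f holomorphic_on UNIV} \<inter> weighted_Lp 2 \<psi>"

text \<open>Orthogonal projection of \<open>f \<in> weighted_Lp 2 \<psi>\<close> onto \<open>fock_space \<psi>\<close>. The element is
  unique as a function, since entire functions that agree almost everywhere are equal.\<close>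

definition bergman_projection ::
    "(complex \<Rightarrow> real) \<Rightarrow> (complex \<Rightarrow> complex) \<Rightarrow> complex \<Rightarrow> complex" where
  "bergman_projection \<psi> f =
     (THE g. g \<in> fock_space \<psi> \<and>
             (\<forall>h\<in>fock_space \<psi>. weighted_inner \<psi> (\<lambda>z. f z - g z) h = 0))"

text \<open>Membership of the image in \<open>weighted_Lp p \<psi>\<close> must be required, because the integral
  defining \<open>weighted_Lp_norm\<close> is \<open>0\<close> for a non-integrable integrand.\<close>

definition bergman_bounded :: "real \<Rightarrow> (complex \<Rightarrow> real) \<Rightarrow> bool" where
  "bergman_bounded p \<psi> \<longleftrightarrow>
     (\<exists>C. \<forall>f \<in> weighted_Lp 2 \<psi> \<inter> weighted_Lp p \<psi>.
        bergman_projection \<psi> f \<in> weighted_Lp p \<psi> \<and>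
        weighted_Lp_norm p \<psi> (bergman_projection \<psi> f) \<le> C * weighted_Lp_norm p \<psi> f)"

text \<open>Derivatives on the closed half-line, one-sided at \<open>0\<close>, so that values at negative
  arguments play no role.\<close>

definition halfline_deriv :: "(real \<Rightarrow> real) \<Rightarrow> real \<Rightarrow> real" where
  "halfline_deriv f r = vector_derivative f (at r within {0..})"

definition smooth_on_halfline :: "(real \<Rightarrow> real) \<Rightarrow> bool" where
  "smooth_on_halfline f \<longleftrightarrow> (\<forall>n. (halfline_deriv ^^ n) f differentiable_on {0..})"

end

theory Submission
  imports Defs "HOL-Complex_Analysis.Great_Picard"
begin

text \<open>For \<open>p = 2\<close> the projection exists, since a minimizing sequence for the distance to the Fock space
  is locally bounded and Montel's theorem with Fatou's lemma yields a minimizer; it is a contraction.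

  For \<open>p \<noteq> 2\<close> take \<open>f z = z ^ n * indicator S z\<close> with \<open>S\<close> rotation invariant. Then the projection of
  \<open>f\<close> is \<open>c * z ^ n\<close>, where \<open>c\<close> is the fraction of the mass of \<open>\<bar>z\<bar> ^ (2 * n) * exp (- 2 * \<phi> \<bar>z\<bar>)\<close> that
  lies in \<open>S\<close>. The hypothesis \<open>\<phi>'' = o(\<phi>' ^ 2)\<close> makes the density of this mass in the variable \<open>ln \<bar>z\<bar>\<close> flat near
  its maximum on any scale \<open>B/n\<close>. So for every \<open>b\<close> there are \<open>n\<close> and radii \<open>\<rho> < \<rho> * s\<close> with
  \<open>s ^ n \<ge> 1 + b/2\<close> such that a quarter of the mass lies inside \<open>\<rho>\<close> and a quarter outside
  \<open>\<rho> * s\<close>. With \<open>S = {\<bar>z\<bar> < \<rho>}\<close> if \<open>p > 2\<close> and \<open>S = {\<bar>z\<bar> \<ge> \<rho> * s}\<close> if \<open>p < 2\<close>, the projection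
  transports mass to where \<open>\<bar>z\<bar> ^ (n * (p - 2))\<close> is larger by the factor \<open>s ^ (n * \<bar>p - 2\<bar>)\<close>, which is
  unbounded.\<close>

section \<open>Rotation invariance of area measure\<close>

text \<open>\<open>measure_orthogonal_image\<close> concerns maps of \<open>real ^ 'n\<close>. In
  these coordinates multiplication by a complex number of modulus 1 becomes an orthogonal
  transformation.\<close>

definition vec_of_complex :: "complex \<Rightarrow> real ^ 2" where
  "vec_of_complex z = vector [Re z, Im z]"

definition complex_of_vec :: "real ^ 2 \<Rightarrow> complex" where
  "complex_of_vec v = Complex (v $ 1) (v $ 2)"

lemma complex_of_vec_of_complex [simp]: "complex_of_vec (vec_of_complex z) = z"
  by (simp add: complex_of_vec_def vec_of_complex_def)

lemma vec_of_complex_of_vec [simp]: "vec_of_complex (complex_of_vec v) = v"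
  by (simp add: complex_of_vec_def vec_of_complex_def vec_eq_iff forall_2)

lemma continuous_complex_of_vec: "continuous_on UNIV complex_of_vec"
  unfolding complex_of_vec_def Complex_eq by (intro continuous_intros)

lemma continuous_vec_of_complex: "continuous_on UNIV vec_of_complex"
proof -
  have eq: "vec_of_complex = (\<lambda>z. \<chi> i. if i = 1 then Re z else Im z)"
    by (simp add: fun_eq_iff vec_eq_iff forall_2 vec_of_complex_def)
  have "continuous_on UNIV (\<lambda>z. if i = 1 then Re z else Im z)" for i :: 2
    by (cases "i = 1") (auto intro!: continuous_intros)
  then show ?thesis unfolding eq by (rule continuous_on_vec_lambda)
qed

lemma borel_measurable_complex_of_vec [measurable]: "complex_of_vec \<in> borel_measurable borel"
  by (intro borel_measurable_continuous_onI continuous_complex_of_vec)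

lemma borel_measurable_vec_of_complex [measurable]: "vec_of_complex \<in> borel_measurable borel"
  by (intro borel_measurable_continuous_onI continuous_vec_of_complex)

lemma vimage_complex_of_vec_box:
  "complex_of_vec -` box l u = box (vec_of_complex l) (vec_of_complex u)"
  by (auto simp: complex_of_vec_def vec_of_complex_def box_def Basis_complex_def Basis_vec_def
       inner_axis forall_2)

text \<open>The coordinate map matches boxes with boxes of the same side lengths, and the values on
  boxes determine \<open>lborel\<close>.\<close>

lemma distr_lborel_complex_of_vec: "distr lborel borel complex_of_vec = lborel"
proof (rule lborel_eqI[symmetric])
  fix l u :: complex
  assume le: "\<And>b. b \<in> Basis \<Longrightarrow> l \<bullet> b \<le> u \<bullet> b"
  have B2: "(Basis :: (real^2) set) = {axis 1 1, axis 2 1}"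
    by (auto simp: Basis_vec_def UNIV_2)
  have le': "\<And>b. b \<in> Basis \<Longrightarrow> vec_of_complex l \<bullet> b \<le> vec_of_complex u \<bullet> b"
    using le[of 1] le[of \<i>] by (auto simp: vec_of_complex_def Basis_complex_def B2 inner_axis)
  have ne: "(axis 1 1 :: real^2) \<noteq> axis 2 1" by (simp add: axis_eq_axis)
  show "emeasure (distr lborel borel complex_of_vec) (box l u) = ennreal (\<Prod>b\<in>Basis. (u - l) \<bullet> b)"
    using emeasure_lborel_box[OF le'] ne
    by (subst emeasure_distr)
       (auto simp: vimage_complex_of_vec_box inner_diff_left B2 Basis_complex_def inner_axis vec_of_complex_def)
qed simp

text \<open>The preimage of a box is its image under the inverse, which is again orthogonal and so
  preserves Lebesgue measure. The preimage is a Borel set, hence the completed measure agrees with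
  \<open>lborel\<close> on it.\<close>

lemma distr_lborel_orthogonal:
  fixes g :: "real ^ 2 \<Rightarrow> real ^ 2"
  assumes g: "orthogonal_transformation g"
  shows "distr lborel borel g = lborel"
proof (rule lborel_eqI[symmetric])
  fix l u :: "real ^ 2"
  assume le: "\<And>b. b \<in> Basis \<Longrightarrow> l \<bullet> b \<le> u \<bullet> b"
  have bij: "bij g" using g by (simp add: orthogonal_transformation_bij)
  have inv: "orthogonal_transformation (inv g)" using g by (simp add: orthogonal_transformation_inv)
  have lin: "linear g" using g by (simp add: orthogonal_transformation_linear)
  have m[measurable]: "g \<in> borel_measurable borel"
    by (intro borel_measurable_continuous_onI linear_continuous_on) (simp add: lin linear_conv_bounded_linear[symmetric])
  have eq: "g -` box l u = inv g ` box l u" using bij by (simp add: bij_vimage_eq_inv_image)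
  have b: "box l u \<in> lmeasurable" by simp
  have "measure lebesgue (inv g ` box l u) = measure lebesgue (box l u)"
    and im: "inv g ` box l u \<in> lmeasurable"
    using measure_orthogonal_image[OF inv b] measurable_orthogonal_image[OF inv b] by auto
  then have "emeasure lebesgue (inv g ` box l u) = emeasure lebesgue (box l u)"
    by (simp add: emeasure_eq_measure2 b)
  moreover have "emeasure lebesgue (inv g ` box l u) = emeasure lborel (inv g ` box l u)"
  proof -
    have "inv g ` box l u \<in> sets borel" using measurable_sets[OF m, of "box l u"] eq by simp
    then show ?thesis by (simp add: emeasure_completion)
  qed
  ultimately show "emeasure (distr lborel borel g) (box l u) = ennreal (\<Prod>b\<in>Basis. (u - l) \<bullet> b)"
    using emeasure_lborel_box[OF le]
    by (subst emeasure_distr) (auto simp: eq)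
qed simp

lemma distr_lborel_mult_unit:
  assumes u: "cmod u = 1"
  shows "distr lborel borel (\<lambda>z. u * z) = lborel"
proof -
  define g where "g v = vec_of_complex (u * complex_of_vec v)" for v
  have norm_eq: "norm (vec_of_complex z) = cmod z" for z
    by (simp add: vec_of_complex_def norm_vec_def L2_set_def sum_2 cmod_def)
  have norm_eq': "cmod (complex_of_vec v) = norm v" for v
    using norm_eq[of "complex_of_vec v"] by simp
  have lin: "linear g"
    by (rule linearI) (auto simp: g_def vec_of_complex_def complex_of_vec_def vec_eq_iff forall_2 algebra_simps)
  have "orthogonal_transformation g"
    unfolding orthogonal_transformation using lin by (simp add: g_def norm_eq norm_eq' norm_mult u)
  then have g: "distr lborel borel g = lborel" by (rule distr_lborel_orthogonal)
  have [measurable]: "(\<lambda>z. u * z) \<in> borel_measurable borel" by measurable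
  have [measurable]: "g \<in> borel_measurable borel" unfolding g_def by measurable
  have "distr lborel borel (\<lambda>z. u * z) = distr (distr lborel borel complex_of_vec) borel (\<lambda>z. u * z)"
    by (simp add: distr_lborel_complex_of_vec)
  also have "\<dots> = distr lborel borel (complex_of_vec \<circ> g)"
    by (subst distr_distr) (auto simp: g_def comp_def)
  also have "\<dots> = distr (distr lborel borel g) borel complex_of_vec"
    by (subst distr_distr) auto
  also have "\<dots> = lborel" by (simp add: g distr_lborel_complex_of_vec)
  finally show ?thesis .
qed

lemma area_measure_simps [simp, measurable_cong]:
  "sets area_measure = sets borel" "space area_measure = UNIV"
  by (auto simp: area_measure_def)

lemma sigma_finite_area_measure: "sigma_finite_measure area_measure"
  unfolding area_measure_def by (subst sigma_finite_measure.sigma_finite_iff_density_finite[OF sigma_finite_lborel]) auto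

lemma distr_area_measure_mult_unit:
  assumes "cmod u = 1"
  shows "distr area_measure borel (\<lambda>z. u * z) = area_measure"
proof -
  have "distr (density lborel (\<lambda>_. ennreal (1 / pi))) borel (\<lambda>z. u * z)
      = density (distr lborel borel (\<lambda>z. u * z)) (\<lambda>_. ennreal (1 / pi))"
    by (subst density_distr) auto
  then show ?thesis by (simp add: area_measure_def comp_def distr_lborel_mult_unit assms)
qed

section \<open>Rotational means of entire functions\<close>

text \<open>Cauchy's formula for the \<open>n\<close>-th derivative at 0 of
  \<open>u \<mapsto> h (z * u)\<close>, written out on the unit circle. The chain rule supplies
  \<open>z ^ n\<close>, and the rescaling keeps \<open>z = 0\<close> from being a special
  case.\<close>

lemma circle_mean_power:
  assumes h: "h holomorphic_on UNIV"
  shows "((\<lambda>x. h (z * cis (2 * pi * x)) * cis (- 2 * pi * x) ^ n) has_integral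
           (deriv ^^ n) h 0 / fact n * z ^ n) {0..1}"
proof -
  have hz: "(\<lambda>u. h (z * u)) holomorphic_on UNIV"
    using holomorphic_on_compose_gen[of "\<lambda>u. z * u" UNIV h UNIV] h
    by (auto simp: comp_def intro!: holomorphic_intros)
  have "((\<lambda>u. h (z * u) / (u - 0) ^ Suc n) has_contour_integral
          2 * pi * \<i> / fact n * (deriv ^^ n) (\<lambda>u. h (z * u)) 0) (circlepath 0 1)"
    by (rule Cauchy_has_contour_integral_higher_derivative_circlepath)
       (auto intro: holomorphic_on_subset[OF hz] holomorphic_on_imp_continuous_on)
  also have "(deriv ^^ n) (\<lambda>u. h (z * u)) 0 = z ^ n * (deriv ^^ n) h 0"
    using higher_deriv_compose_linear[OF h, of UNIV 0 z n] by simp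
  finally have contour: "((\<lambda>u. h (z * u) / (u - 0) ^ Suc n) has_contour_integral
      2 * pi * \<i> / fact n * (z ^ n * (deriv ^^ n) h 0)) (circlepath 0 1)" .
  have "circlepath 0 1 x = cis (2 * pi * x)" for x
    by (simp add: circlepath cis_conv_exp mult_ac)
  moreover have "vector_derivative (circlepath 0 1) (at x within {0..1}) = 2 * pi * \<i> * cis (2 * pi * x)"
    if "x \<in> {0..1}" for x
    using that by (subst vector_derivative_circlepath01) (auto simp: cis_conv_exp mult_ac)
  ultimately have "((\<lambda>x. (h (z * cis (2 * pi * x)) / cis (2 * pi * x) ^ Suc n) * (2 * pi * \<i> * cis (2 * pi * x)))
      has_integral 2 * pi * \<i> / fact n * (z ^ n * (deriv ^^ n) h 0)) {0..1}"
    using contour unfolding has_contour_integral_def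
    by (elim has_integral_eq[rotated]) (simp add: mult_ac)
  from has_integral_mult_right[OF this, of "1 / (2 * pi * \<i>)"]
  have "((\<lambda>x. 1 / (2 * pi * \<i>) * ((h (z * cis (2 * pi * x)) / cis (2 * pi * x) ^ Suc n) * (2 * pi * \<i> * cis (2 * pi * x))))
      has_integral (deriv ^^ n) h 0 / fact n * z ^ n) {0..1}"
    by (simp add: field_simps)
  moreover have "1 / (2 * pi * \<i>) * ((h (z * cis (2 * pi * x)) / cis (2 * pi * x) ^ Suc n) * (2 * pi * \<i> * cis (2 * pi * x)))
     = h (z * cis (2 * pi * x)) * cis (- 2 * pi * x) ^ n" for x
  proof -
    define w where "w = cis (2 * pi * x)"
    have w: "w \<noteq> 0" by (simp add: w_def)
    have inv: "cis (- 2 * pi * x) = inverse w" by (simp add: cis_inverse w_def)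
    have "1 / (2 * pi * \<i>) * (a / w ^ Suc n * (2 * pi * \<i> * w)) = a / w ^ n" for a
      using w by (simp add: field_simps)
    then show ?thesis unfolding inv w_def[symmetric] by (simp only: power_inverse divide_inverse)
  qed
  ultimately show ?thesis by (simp cong: has_integral_cong)
qed

text \<open>Averaging over all rotations of the plane replaces \<open>h\<close> by its \<open>n\<close>-th Taylor term.\<close>

lemma integral_radial_times_entire:
  fixes k :: "real \<Rightarrow> real"
  assumes h: "h holomorphic_on UNIV"
    and k [measurable]: "k \<in> borel_measurable borel"
    and int: "integrable area_measure (\<lambda>z. of_real (k (cmod z)) * cnj z ^ n * h z)"
  shows "(LINT z|area_measure. of_real (k (cmod z)) * cnj z ^ n * h z) =
         (deriv ^^ n) h 0 / fact n * of_real (LINT z|area_measure. k (cmod z) * cmod z ^ (2 * n))"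
proof -
  interpret M: sigma_finite_measure area_measure by (rule sigma_finite_area_measure)
  \<comment> \<open>The uniform probability measure on the unit interval turns the average over the
    angle \<open>2 * pi * x\<close> into an integral to which Fubini applies.\<close>
  define U where "U = density lborel (\<lambda>x. indicator {0..1::real} x :: ennreal)"
  have U_sets [measurable_cong, simp]: "sets U = sets borel" "space U = UNIV" by (auto simp: U_def)
  have U_UNIV: "emeasure U UNIV = 1" by (simp add: U_def emeasure_density)
  interpret U: finite_measure U by (rule finite_measureI) (simp add: U_UNIV)
  interpret UM: pair_sigma_finite U area_measure ..
  define F where "F z = of_real (k (cmod z)) * cnj z ^ n * h z" for z
  have hc: "continuous_on UNIV h" using h by (rule holomorphic_on_imp_continuous_on)
  then have h_m [measurable]: "h \<in> borel_measurable borel" by (rule borel_measurable_continuous_onI)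
  have cnj_m [measurable]: "cnj \<in> borel_measurable borel"
    by (intro borel_measurable_continuous_onI continuous_intros)
  have F_m [measurable]: "F \<in> borel_measurable borel" unfolding F_def by measurable
  have cis_m [measurable]: "(\<lambda>x. cis (2 * pi * x)) \<in> borel_measurable borel"
    by (intro borel_measurable_continuous_onI continuous_intros)
  have rot: "integrable area_measure (\<lambda>z. f (cis t * z)) \<longleftrightarrow> integrable area_measure f"
       "(LINT z|area_measure. f (cis t * z)) = integral\<^sup>L area_measure f"
    if "f \<in> borel_measurable borel" for f :: "complex \<Rightarrow> 'b :: {banach, second_countable_topology}" and t
  proof -
    have [measurable]: "(\<lambda>z. cis t * z) \<in> measurable area_measure borel" by measurable
    have d: "distr area_measure borel (\<lambda>z. cis t * z) = area_measure"
      by (rule distr_area_measure_mult_unit) simp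
    show "integrable area_measure (\<lambda>z. f (cis t * z)) \<longleftrightarrow> integrable area_measure f"
      using integrable_distr_eq[of "\<lambda>z. cis t * z" area_measure borel f] that d by simp
    show "(LINT z|area_measure. f (cis t * z)) = integral\<^sup>L area_measure f"
      using integral_distr[of "\<lambda>z. cis t * z" area_measure borel f] that d by simp
  qed
  have int_F: "integrable area_measure F" using int by (simp add: F_def[abs_def])
  \<comment> \<open>By rotation invariance the inner integral of the norm is the same for every
    angle, and a constant is integrable over the finite measure \<open>U\<close>.\<close>
  have int_pair: "integrable (U \<Otimes>\<^sub>M area_measure) (\<lambda>(x, z). F (cis (2 * pi * x) * z))"
  proof (rule UM.Fubini_integrable)
    show "(\<lambda>(x, z). F (cis (2 * pi * x) * z)) \<in> borel_measurable (U \<Otimes>\<^sub>M area_measure)"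
      by measurable
    have "(\<integral>y. norm (F (cis (2 * pi * x) * y)) \<partial>area_measure) = (\<integral>y. norm (F y) \<partial>area_measure)" for x
      using rot(2)[of "\<lambda>z. norm (F z)" "2 * pi * x"] by simp
    then show "integrable U (\<lambda>x. \<integral>y. norm (case (x, y) of (x, z) \<Rightarrow> F (cis (2 * pi * x) * z)) \<partial>area_measure)"
      by simp
    show "AE x in U. integrable area_measure (\<lambda>y. case (x, y) of (x, z) \<Rightarrow> F (cis (2 * pi * x) * z))"
      using rot(1)[OF F_m] int_F by simp
  qed
  \<comment> \<open>The radial factor ignores the rotation. The factor \<open>cnj z ^ n\<close>
    contributes \<open>cis (- 2 * pi * x) ^ n\<close>, which singles out the \<open>n\<close>-th
    Taylor term of \<open>h\<close>.\<close>
  have mean: "(\<integral>x. F (cis (2 * pi * x) * z) \<partial>U) =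
      (deriv ^^ n) h 0 / fact n * of_real (k (cmod z) * cmod z ^ (2 * n))" for z
  proof -
    have "(\<integral>x. F (cis (2 * pi * x) * z) \<partial>U)
        = (\<integral>x. indicat_real {0..1} x *\<^sub>R F (cis (2 * pi * x) * z) \<partial>lborel)"
    proof -
      have U_eq: "U = density lborel (\<lambda>x. ennreal (indicat_real {0..1} x))"
        unfolding U_def by (simp add: ennreal_indicator)
      show ?thesis unfolding U_eq by (subst integral_density) auto
    qed
    also have "\<dots> = (LINT x:{0..1}|lborel. F (cis (2 * pi * x) * z))"
      by (simp add: set_lebesgue_integral_def)
    also have "\<dots> = (LINT x:{0..1}|lborel. of_real (k (cmod z)) * cnj z ^ n * (h (z * cis (2 * pi * x)) * cis (- 2 * pi * x) ^ n))"
      by (intro arg_cong[where f = "\<lambda>f. set_lebesgue_integral lborel {0..1} f"] ext)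
         (simp add: F_def norm_mult power_mult_distrib cis_cnj mult_ac)
    also have "\<dots> = of_real (k (cmod z)) * cnj z ^ n * (LINT x:{0..1}|lborel. h (z * cis (2 * pi * x)) * cis (- 2 * pi * x) ^ n)"
      by simp
    also have "(LINT x:{0..1}|lborel. h (z * cis (2 * pi * x)) * cis (- 2 * pi * x) ^ n)
        = integral {0..1} (\<lambda>x. h (z * cis (2 * pi * x)) * cis (- 2 * pi * x) ^ n)"
      by (rule set_borel_integral_eq_integral)
         (auto intro!: borel_integrable_atLeastAtMost' continuous_intros continuous_on_compose2[OF hc])
    also have "\<dots> = (deriv ^^ n) h 0 / fact n * z ^ n"
      by (rule integral_unique[OF circle_mean_power[OF h]])
    also have "of_real (k (cmod z)) * cnj z ^ n * ((deriv ^^ n) h 0 / fact n * z ^ n)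
        = (deriv ^^ n) h 0 / fact n * of_real (k (cmod z) * cmod z ^ (2 * n))"
    proof -
      have "cnj z ^ n * z ^ n = of_real (cmod z ^ (2 * n))"
        by (metis complex_norm_square mult.commute of_real_power power_mult power_mult_distrib)
      then show ?thesis by (simp add: mult_ac)
    qed
    finally show ?thesis .
  qed
  have "(LINT z|area_measure. F z) = (\<integral>x. (\<integral>z. F (cis (2 * pi * x) * z) \<partial>area_measure) \<partial>U)"
    using rot(2)[OF F_m] by (simp add: measure_def U_UNIV)
  also have "\<dots> = (\<integral>z. (\<integral>x. F (cis (2 * pi * x) * z) \<partial>U) \<partial>area_measure)"
    using UM.Fubini_integral[of "\<lambda>x z. F (cis (2 * pi * x) * z)"] int_pair by simp
  also have "\<dots> = (deriv ^^ n) h 0 / fact n * of_real (LINT z|area_measure. k (cmod z) * cmod z ^ (2 * n))"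
    by (simp only: mean integral_mult_right_zero integral_complex_of_real)
  finally show ?thesis by (simp add: F_def)
qed

section \<open>Discs, translations and the mean value property over a disc\<close>

lemma emeasure_area_measure_ball:
  assumes "0 \<le> r"
  shows "emeasure area_measure (ball a r) = ennreal (r\<^sup>2)"
proof -
  have "emeasure area_measure (ball a r) = ennreal (1 / pi) * emeasure lborel (ball a r)"
    unfolding area_measure_def by (simp add: emeasure_density_const)
  also have "\<dots> = ennreal (1 / pi) * ennreal (pi * r\<^sup>2)"
    using assms by (simp add: emeasure_ball unit_ball_vol_2)
  also have "\<dots> = ennreal (r\<^sup>2)"
    by (subst ennreal_mult'[symmetric]) auto
  finally show ?thesis .
qed

lemma measure_area_measure_ball: "0 \<le> r \<Longrightarrow> measure area_measure (ball a r) = r\<^sup>2"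
  by (simp add: measure_def emeasure_area_measure_ball)

lemma distr_area_measure_plus: "distr area_measure borel (\<lambda>z. a + z) = area_measure"
proof -
  have "distr (density lborel (\<lambda>_. ennreal (1 / pi))) borel (\<lambda>z. a + z)
      = density (distr lborel borel (\<lambda>z. a + z)) (\<lambda>_. ennreal (1 / pi))"
    by (subst density_distr) auto
  then show ?thesis by (simp add: area_measure_def lborel_distr_plus)
qed

text \<open>The case \<open>n = 0\<close> of \<open>integral_radial_times_entire\<close>, for the
  indicator of the unit disc and the translate of \<open>h\<close> by \<open>a\<close>, is the mean
  value property over a disc of normalised area 1. The estimate of the modulus by 1 plus its square
  then replaces the Cauchy-Schwarz inequality, at the price of homogeneity.\<close>

lemma cmod_le_local_integral:
  assumes h: "h holomorphic_on UNIV"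
  shows "cmod (h a) \<le> (LINT z|area_measure. indicator (ball a 1) z * (1 + (cmod (h z))\<^sup>2))"
proof -
  define k :: "real \<Rightarrow> real" where "k = indicator {..<1}"
  define H where "H z = h (a + z)" for z
  have "(\<lambda>z. a + z) holomorphic_on UNIV" by (intro holomorphic_intros)
  then have H: "H holomorphic_on UNIV"
    using holomorphic_on_compose_gen[of "\<lambda>z. a + z" UNIV h UNIV] h
    by (simp add: comp_def H_def[abs_def])
  have hc: "continuous_on UNIV h" using h by (rule holomorphic_on_imp_continuous_on)
  have [measurable]: "h \<in> borel_measurable borel" using hc by (rule borel_measurable_continuous_onI)
  have Hc: "continuous_on UNIV H" using H by (rule holomorphic_on_imp_continuous_on)
  have H_m [measurable]: "H \<in> borel_measurable borel" using Hc by (rule borel_measurable_continuous_onI)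
  have k_m: "k \<in> borel_measurable borel" by (simp add: k_def)
  have kc: "k (cmod z) = indicator (ball 0 1) z" for z by (auto simp: k_def indicator_def)
  have [measurable]: "ball 0 1 \<in> sets (borel :: complex measure)" "ball a 1 \<in> sets (borel :: complex measure)" by auto
  have fin: "emeasure area_measure (ball 0 1) < \<infinity>"
    using emeasure_area_measure_ball[of 1 0] by simp
  obtain B where B: "\<And>z. z \<in> cball 0 1 \<Longrightarrow> cmod (H z) \<le> B"
    using compact_imp_bounded[OF compact_continuous_image[OF continuous_on_subset[OF Hc] compact_cball]]
    unfolding bounded_iff by (metis image_eqI subset_UNIV)
  have int: "integrable area_measure (\<lambda>z. indicat_real (ball 0 1) z *\<^sub>R H z)"
  proof (rule Bochner_Integration.integrable_bound)
    show "integrable area_measure (\<lambda>z. B * indicat_real (ball 0 1) z)"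
      using fin by auto
    show "AE z in area_measure. norm (indicat_real (ball 0 1) z *\<^sub>R H z) \<le> norm (B * indicat_real (ball 0 1) z)"
    proof (rule AE_I2)
      fix z show "norm (indicat_real (ball 0 1) z *\<^sub>R H z) \<le> norm (B * indicat_real (ball 0 1) z)"
        using B[of z] by (auto simp: indicator_def)
    qed
  qed measurable
  have int2: "integrable area_measure (\<lambda>z. indicat_real (ball 0 1) z * (1 + (cmod (H z))\<^sup>2))"
  proof (rule Bochner_Integration.integrable_bound)
    show "integrable area_measure (\<lambda>z. (1 + B\<^sup>2) * indicat_real (ball 0 1) z)"
      using fin by auto
    show "AE z in area_measure. norm (indicat_real (ball 0 1) z * (1 + (cmod (H z))\<^sup>2)) \<le> norm ((1 + B\<^sup>2) * indicat_real (ball 0 1) z)"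
    proof (rule AE_I2)
      fix z show "norm (indicat_real (ball 0 1) z * (1 + (cmod (H z))\<^sup>2)) \<le> norm ((1 + B\<^sup>2) * indicat_real (ball 0 1) z)"
        using B[of z] power_mono[of "cmod (H z)" B 2] by (auto simp: indicator_def)
    qed
  qed measurable
  have "h a = H 0" by (simp add: H_def)
  also have "\<dots> = (LINT z|area_measure. indicat_real (ball 0 1) z *\<^sub>R H z)"
    using integral_radial_times_entire[OF H k_m, of 0] int measure_area_measure_ball[of 1 0]
    by (simp add: kc scaleR_conv_of_real)
  finally have "cmod (h a) \<le> (LINT z|area_measure. norm (indicat_real (ball 0 1) z *\<^sub>R H z))"
    using integral_norm_bound[of area_measure "\<lambda>z. indicat_real (ball 0 1) z *\<^sub>R H z"] by simp
  also have "\<dots> \<le> (LINT z|area_measure. indicat_real (ball 0 1) z * (1 + (cmod (H z))\<^sup>2))"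
  proof (rule integral_mono[OF integrable_norm[OF int] int2])
    fix z show "norm (indicat_real (ball 0 1) z *\<^sub>R H z) \<le> indicat_real (ball 0 1) z * (1 + (cmod (H z))\<^sup>2)"
    proof -
      have "2 * cmod (H z) \<le> 1 + (cmod (H z))\<^sup>2" using sum_squares_bound[of "1" "cmod (H z)"] by simp
      then have "cmod (H z) \<le> 1 + (cmod (H z))\<^sup>2" using norm_ge_zero[of "H z"] by linarith
      then show ?thesis by (auto simp: indicator_def)
    qed
  qed
  also have "\<dots> = (LINT z|area_measure. indicat_real (ball a 1) (a + z) * (1 + (cmod (h (a + z)))\<^sup>2))"
    by (rule Bochner_Integration.integral_cong) (auto simp: H_def indicator_def dist_norm)
  also have "\<dots> = (LINT z|distr area_measure borel (\<lambda>z. a + z). indicat_real (ball a 1) z * (1 + (cmod (h z))\<^sup>2))"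
    by (subst integral_distr) auto
  also have "\<dots> = (LINT z|area_measure. indicat_real (ball a 1) z * (1 + (cmod (h z))\<^sup>2))"
    by (simp only: distr_area_measure_plus)
  finally show ?thesis .
qed

section \<open>Orthogonal projection onto the Fock space\<close>

lemma weighted_Lp_2_iff:
  "f \<in> weighted_Lp 2 \<psi> \<longleftrightarrow> f \<in> borel_measurable borel \<and>
     integrable area_measure (\<lambda>z. (cmod (f z))\<^sup>2 * exp (- 2 * \<psi> z))"
proof -
  have "borel_measurable area_measure = (borel_measurable borel :: (complex \<Rightarrow> complex) set)"
    by (rule measurable_cong_sets) auto
  then show ?thesis by (simp add: weighted_Lp_def)
qed

locale continuous_weight =
  fixes \<psi> :: "complex \<Rightarrow> real"
  assumes continuous_weight: "continuous_on UNIV \<psi>"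
begin

lemma weight_measurable [measurable]: "\<psi> \<in> borel_measurable borel"
  by (rule borel_measurable_continuous_onI[OF continuous_weight])

abbreviation w :: "complex \<Rightarrow> real" where "w z \<equiv> exp (- 2 * \<psi> z)"

definition sqnorm :: "(complex \<Rightarrow> complex) \<Rightarrow> real" where
  "sqnorm f = (LINT z|area_measure. (cmod (f z))\<^sup>2 * w z)"

abbreviation "L2 \<equiv> weighted_Lp 2 \<psi>"
abbreviation "Fock \<equiv> fock_space \<psi>"
abbreviation "inner2 \<equiv> weighted_inner \<psi>"

section \<open>Geometry of the weighted L2 space\<close>

lemma L2_D:
  assumes "f \<in> L2"
  shows "f \<in> borel_measurable borel" "integrable area_measure (\<lambda>z. (cmod (f z))\<^sup>2 * w z)"
  using assms by (auto simp: weighted_Lp_2_iff)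

lemma sqnorm_nonneg: "0 \<le> sqnorm f"
  unfolding sqnorm_def by (rule Bochner_Integration.integral_nonneg) auto

text \<open>One closure property serves for all linear combinations: \<open>c = 1\<close> gives
  differences and \<open>f = 0\<close> gives multiples. The bound is
  \<open>(x + y)^2 \<le> 2 * x^2 + 2 * y^2\<close>.\<close>

lemma L2_diff_mult:
  assumes f: "f \<in> L2" and g: "g \<in> L2"
  shows "(\<lambda>z. f z - c * g z) \<in> L2"
  unfolding weighted_Lp_2_iff
proof
  note [measurable] = L2_D(1)[OF f] L2_D(1)[OF g]
  show "(\<lambda>z. f z - c * g z) \<in> borel_measurable borel" by measurable
  show "integrable area_measure (\<lambda>z. (cmod (f z - c * g z))\<^sup>2 * w z)"
  proof (rule Bochner_Integration.integrable_bound)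
    show "integrable area_measure (\<lambda>z. 2 * ((cmod (f z))\<^sup>2 * w z) + 2 * (cmod c)\<^sup>2 * ((cmod (g z))\<^sup>2 * w z))"
      using L2_D(2)[OF f] L2_D(2)[OF g] by (intro Bochner_Integration.integrable_add integrable_mult_right)
    show "AE z in area_measure. norm ((cmod (f z - c * g z))\<^sup>2 * w z)
        \<le> norm (2 * ((cmod (f z))\<^sup>2 * w z) + 2 * (cmod c)\<^sup>2 * ((cmod (g z))\<^sup>2 * w z))"
    proof (rule AE_I2)
      fix z
      have "cmod (f z - c * g z) \<le> cmod (f z) + cmod c * cmod (g z)"
        by (metis norm_mult norm_triangle_ineq4)
      then have "(cmod (f z - c * g z))\<^sup>2 \<le> (cmod (f z) + cmod c * cmod (g z))\<^sup>2"
        by (intro power_mono) auto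
      also have "\<dots> \<le> 2 * (cmod (f z))\<^sup>2 + 2 * ((cmod c)\<^sup>2 * (cmod (g z))\<^sup>2)"
        using sum_squares_bound[of "cmod (f z)" "cmod c * cmod (g z)"]
        by (simp add: power2_sum power_mult_distrib)
      finally have "(cmod (f z - c * g z))\<^sup>2 * w z \<le> (2 * (cmod (f z))\<^sup>2 + 2 * ((cmod c)\<^sup>2 * (cmod (g z))\<^sup>2)) * w z"
        by (intro mult_right_mono) auto
      then show "norm ((cmod (f z - c * g z))\<^sup>2 * w z)
        \<le> norm (2 * ((cmod (f z))\<^sup>2 * w z) + 2 * (cmod c)\<^sup>2 * ((cmod (g z))\<^sup>2 * w z))"
        by (simp add: algebra_simps)
    qed
  qed measurable
qed

lemma integrable_inner2:
  assumes f: "f \<in> L2" and g: "g \<in> L2"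
  shows "integrable area_measure (\<lambda>z. f z * cnj (g z) * of_real (w z))"
proof (rule Bochner_Integration.integrable_bound)
  note [measurable] = L2_D(1)[OF f] L2_D(1)[OF g]
  have [measurable]: "cnj \<in> borel_measurable borel"
    by (intro borel_measurable_continuous_onI continuous_intros)
  show "(\<lambda>z. f z * cnj (g z) * of_real (w z)) \<in> borel_measurable area_measure" by measurable
  show "integrable area_measure (\<lambda>z. (cmod (f z))\<^sup>2 * w z + (cmod (g z))\<^sup>2 * w z)"
    using L2_D(2)[OF f] L2_D(2)[OF g] by (intro Bochner_Integration.integrable_add)
  show "AE z in area_measure. norm (f z * cnj (g z) * of_real (w z))
      \<le> norm ((cmod (f z))\<^sup>2 * w z + (cmod (g z))\<^sup>2 * w z)"
  proof (rule AE_I2)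
    fix z
    have "cmod (f z) * cmod (g z) \<le> (cmod (f z))\<^sup>2 + (cmod (g z))\<^sup>2"
    proof -
      have "0 \<le> cmod (f z) * cmod (g z)" by simp
      then show ?thesis using sum_squares_bound[of "cmod (f z)" "cmod (g z)"] by linarith
    qed
    then have "cmod (f z) * cmod (g z) * w z \<le> ((cmod (f z))\<^sup>2 + (cmod (g z))\<^sup>2) * w z"
      by (intro mult_right_mono) auto
    then show "norm (f z * cnj (g z) * of_real (w z)) \<le> norm ((cmod (f z))\<^sup>2 * w z + (cmod (g z))\<^sup>2 * w z)"
      by (simp add: norm_mult algebra_simps)
  qed
qed

lemma inner2_diff_left:
  assumes "f \<in> L2" "g \<in> L2" "h \<in> L2"
  shows "inner2 (\<lambda>z. f z - g z) h = inner2 f h - inner2 g h"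
  unfolding weighted_inner_def
  by (subst Bochner_Integration.integral_diff[symmetric, OF integrable_inner2 integrable_inner2])
     (simp_all add: assms left_diff_distrib)

lemma inner2_self: "inner2 f f = of_real (sqnorm f)"
  unfolding weighted_inner_def sqnorm_def integral_complex_of_real[symmetric]
  by (rule Bochner_Integration.integral_cong)
     (auto simp: complex_norm_square[symmetric] simp flip: of_real_mult of_real_power)

text \<open>This expansion drives both the variational argument for orthogonality and the
  Pythagorean identity behind the contraction property.\<close>

lemma sqnorm_diff_mult:
  assumes f: "f \<in> L2" and g: "g \<in> L2"
  shows "sqnorm (\<lambda>z. f z - c * g z) = sqnorm f - 2 * Re (cnj c * inner2 f g) + (cmod c)\<^sup>2 * sqnorm g"
proof -
  have cmod_diff_sq: "(cmod (a - b))\<^sup>2 = (cmod a)\<^sup>2 - 2 * Re (a * cnj b) + (cmod b)\<^sup>2" for a b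
    unfolding cmod_power2 by (simp add: power2_eq_square algebra_simps)
  have pt: "(cmod (f z - c * g z))\<^sup>2 * w z
      = (cmod (f z))\<^sup>2 * w z - 2 * Re (cnj c * (f z * cnj (g z) * of_real (w z))) + (cmod c)\<^sup>2 * ((cmod (g z))\<^sup>2 * w z)" for z
  proof -
    have "Re (cnj c * (f z * cnj (g z) * of_real (w z))) = Re (f z * cnj (c * g z)) * w z"
      by (simp add: algebra_simps)
    then show ?thesis
      unfolding cmod_diff_sq by (simp only: norm_mult power_mult_distrib left_diff_distrib distrib_right mult.assoc)
  qed
  define P where "P z = Re (cnj c * (f z * cnj (g z) * of_real (w z)))" for z
  have Re_int: "integrable area_measure P"
    unfolding P_def[abs_def]
    by (intro integrable_Re integrable_mult_right integrable_inner2 f g)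
  have "sqnorm (\<lambda>z. f z - c * g z) = (LINT z|area_measure. (cmod (f z))\<^sup>2 * w z)
     - 2 * (LINT z|area_measure. P z)
     + (cmod c)\<^sup>2 * (LINT z|area_measure. (cmod (g z))\<^sup>2 * w z)"
    unfolding sqnorm_def pt P_def[symmetric] using Re_int L2_D(2)[OF f] L2_D(2)[OF g] by simp
  also have "(LINT z|area_measure. P z) = Re (cnj c * inner2 f g)"
    unfolding P_def weighted_inner_def
    by (subst integral_mult_right_zero[symmetric], subst integral_Re)
       (intro integrable_mult_right integrable_inner2 f g, simp)
  finally show ?thesis by (simp add: sqnorm_def)
qed

section \<open>Point evaluations on the Fock space and uniqueness of the projection\<close>

lemma Fock_D: "h \<in> Fock \<Longrightarrow> h holomorphic_on UNIV" "h \<in> Fock \<Longrightarrow> h \<in> L2"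
  by (auto simp: fock_space_def)

lemma Fock_diff_mult:
  assumes "f \<in> Fock" "g \<in> Fock"
  shows "(\<lambda>z. f z - c * g z) \<in> Fock"
  using assms L2_diff_mult by (auto simp: fock_space_def intro!: holomorphic_intros)

lemma Fock_zero: "(\<lambda>z. 0) \<in> Fock"
  by (simp add: fock_space_def weighted_Lp_2_iff)

text \<open>On the unit disc about \<open>a\<close> one has
  \<open>1 \<le> exp (2 * M) * w z\<close>, so the unweighted local integral is controlled by the
  weighted norm. The bound provides the local boundedness required by Montel's theorem.\<close>

lemma Fock_local_bound:
  assumes h: "h \<in> Fock" and M: "\<And>z. z \<in> cball a 1 \<Longrightarrow> \<psi> z \<le> M"
  shows "cmod (h a) \<le> 1 + exp (2 * M) * sqnorm h"
proof -
  have [measurable]: "h \<in> borel_measurable borel" using L2_D(1) Fock_D h by blast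
  have [measurable]: "ball a 1 \<in> sets (borel :: complex measure)" by simp
  have fin: "emeasure area_measure (ball a 1) < \<infinity>"
    using emeasure_area_measure_ball[of 1 a] by simp
  have bd: "integrable area_measure (\<lambda>z. indicat_real (ball a 1) z + exp (2 * M) * ((cmod (h z))\<^sup>2 * w z))"
    using fin L2_D(2)[OF Fock_D(2)[OF h]] by (intro Bochner_Integration.integrable_add integrable_mult_right) auto
  have le: "indicat_real (ball a 1) z * (1 + (cmod (h z))\<^sup>2)
      \<le> indicat_real (ball a 1) z + exp (2 * M) * ((cmod (h z))\<^sup>2 * w z)" for z
  proof (cases "z \<in> ball a 1")
    case True
    then have "1 \<le> exp (2 * M) * w z" using M[of z] by (simp add: exp_add[symmetric])
    then have "(cmod (h z))\<^sup>2 * 1 \<le> (cmod (h z))\<^sup>2 * (exp (2 * M) * w z)"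
      by (intro mult_left_mono) auto
    then show ?thesis using True by (simp add: mult_ac)
  qed auto
  have "cmod (h a) \<le> (LINT z|area_measure. indicator (ball a 1) z * (1 + (cmod (h z))\<^sup>2))"
    by (rule cmod_le_local_integral[OF Fock_D(1)[OF h]])
  also have "\<dots> \<le> (LINT z|area_measure. indicat_real (ball a 1) z + exp (2 * M) * ((cmod (h z))\<^sup>2 * w z))"
  proof (rule integral_mono[OF _ bd le])
    show "integrable area_measure (\<lambda>z. indicat_real (ball a 1) z * (1 + (cmod (h z))\<^sup>2))"
    proof (rule Bochner_Integration.integrable_bound[OF bd])
      show "AE z in area_measure. norm (indicat_real (ball a 1) z * (1 + (cmod (h z))\<^sup>2))
         \<le> norm (indicat_real (ball a 1) z + exp (2 * M) * ((cmod (h z))\<^sup>2 * w z))"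
      proof (rule AE_I2)
        fix z
        have "0 \<le> indicat_real (ball a 1) z * (1 + (cmod (h z))\<^sup>2)" by simp
        then show "norm (indicat_real (ball a 1) z * (1 + (cmod (h z))\<^sup>2))
         \<le> norm (indicat_real (ball a 1) z + exp (2 * M) * ((cmod (h z))\<^sup>2 * w z))"
          using le[of z] by simp
      qed
    qed measurable
  qed
  also have "\<dots> = measure area_measure (ball a 1) + exp (2 * M) * sqnorm h"
    using fin L2_D(2)[OF Fock_D(2)[OF h]] by (simp add: sqnorm_def)
  finally show ?thesis by (simp add: measure_area_measure_ball)
qed

lemma weight_bounded_on_cball: "\<exists>M. \<forall>z\<in>cball a r. \<psi> z \<le> M"
proof -
  have "bounded (\<psi> ` cball a r)"
    by (intro compact_imp_bounded compact_continuous_image continuous_on_subset[OF continuous_weight]) auto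
  then show ?thesis unfolding bounded_iff by (metis abs_le_D1 image_eqI real_norm_def)
qed

text \<open>The local bound, applied to all multiples of \<open>h\<close>, is not homogeneous and so forces \<open>h = 0\<close>.\<close>

lemma Fock_sqnorm_eq_0:
  assumes h: "h \<in> Fock" and "sqnorm h = 0"
  shows "h a = 0"
proof (rule ccontr)
  assume nz: "h a \<noteq> 0"
  \<comment> \<open>The multiple \<open>c * h\<close> has modulus 2 at \<open>a\<close>, while the
    local bound for a function of norm 0 allows at most 1.\<close>
  define c where "c = of_real (2 / cmod (h a)) * (1::complex)"
  have c: "(\<lambda>z. 0 - c * h z) \<in> Fock" by (rule Fock_diff_mult[OF Fock_zero h])
  have "sqnorm (\<lambda>z. 0 - c * h z) = 0"
    using sqnorm_diff_mult[OF Fock_D(2)[OF Fock_zero] Fock_D(2)[OF h], of c] assms(2)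
    by (simp add: weighted_inner_def sqnorm_def)
  moreover obtain M where "\<forall>z\<in>cball a 1. \<psi> z \<le> M" using weight_bounded_on_cball by blast
  ultimately have "cmod (0 - c * h a) \<le> 1" using Fock_local_bound[OF c, of a M] by simp
  then show False using nz by (simp add: c_def norm_mult norm_divide)
qed

text \<open>The description in \<open>bergman_projection\<close> calls for uniqueness. The
  difference of two candidates lies in the Fock space and is orthogonal to itself, so by
  \<open>Fock_sqnorm_eq_0\<close> it vanishes at every point.\<close>

lemma bergman_projection_eqI:
  assumes f: "f \<in> L2" and g: "g \<in> Fock"
    and orth: "\<And>h. h \<in> Fock \<Longrightarrow> inner2 (\<lambda>z. f z - g z) h = 0"
  shows "bergman_projection \<psi> f = g"
  unfolding bergman_projection_def
proof (rule the_equality)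
  show "g \<in> Fock \<and> (\<forall>h\<in>Fock. inner2 (\<lambda>z. f z - g z) h = 0)" using g orth by blast
next
  fix g' assume g': "g' \<in> Fock \<and> (\<forall>h\<in>Fock. inner2 (\<lambda>z. f z - g' z) h = 0)"
  define e where "e z = g' z - g z" for z
  have e: "e \<in> Fock" using Fock_diff_mult[of g' g 1] g g' by (simp add: e_def[abs_def])
  have 1: "inner2 f e - inner2 g e = 0"
    using orth[OF e] inner2_diff_left[OF f Fock_D(2)[OF g] Fock_D(2)[OF e]] by simp
  have 2: "inner2 f e - inner2 g' e = 0"
    using g' e inner2_diff_left[OF f Fock_D(2) Fock_D(2)[OF e], of g'] by simp
  have "inner2 e e = inner2 g' e - inner2 g e"
    using inner2_diff_left[OF Fock_D(2) Fock_D(2)[OF g] Fock_D(2)[OF e], of g'] g'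
    by (simp add: e_def[abs_def])
  with 1 2 have "inner2 e e = 0" by simp
  then have "sqnorm e = 0" by (simp add: inner2_self)
  then have "e z = 0" for z using Fock_sqnorm_eq_0 e by blast
  then show "g' = g" by (simp add: e_def fun_eq_iff)
qed

text \<open>A minimising sequence is bounded in norm, hence locally bounded, and Montel's theorem
  yields an entire pointwise limit of a subsequence. Fatou's lemma shows at once that this limit
  lies in L2 and that it attains the infimum.\<close>

lemma exists_nearest_in_Fock:
  assumes f: "f \<in> L2"
  shows "\<exists>g\<in>Fock. \<forall>h\<in>Fock. sqnorm (\<lambda>z. f z - g z) \<le> sqnorm (\<lambda>z. f z - h z)"
proof -
  define D where "D = (\<lambda>h. sqnorm (\<lambda>z. f z - h z)) ` Fock"
  define d where "d = Inf D"
  have D_ne: "D \<noteq> {}" using Fock_zero by (auto simp: D_def)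
  have D_bdd: "bdd_below D" by (rule bdd_belowI[of _ 0]) (auto simp: D_def sqnorm_nonneg)
  have d_le: "d \<le> sqnorm (\<lambda>z. f z - h z)" if "h \<in> Fock" for h
    unfolding d_def using that D_bdd by (intro cInf_lower) (auto simp: D_def)
  have "\<exists>h\<in>Fock. sqnorm (\<lambda>z. f z - h z) < d + 1 / real (Suc j)" for j
    using cInf_lessD[OF D_ne, of "d + 1 / real (Suc j)"] by (auto simp: d_def D_def)
  then obtain G where G: "\<And>j. G j \<in> Fock" "\<And>j. sqnorm (\<lambda>z. f z - G j z) < d + 1 / real (Suc j)"
    by metis
  have diff_L2: "(\<lambda>z. f z - h z) \<in> L2" if "h \<in> Fock" for h
    using L2_diff_mult[OF f Fock_D(2)[OF that], of 1] by simp
  have G_sqnorm: "sqnorm (G j) \<le> 2 * sqnorm f + 2 * (d + 1)" for j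
  proof -
    have gj: "G j \<in> L2" using Fock_D G by blast
    have pt: "(cmod (G j z))\<^sup>2 * w z \<le> 2 * ((cmod (f z))\<^sup>2 * w z) + 2 * ((cmod (f z - G j z))\<^sup>2 * w z)" for z
    proof -
      have "cmod (G j z) \<le> cmod (f z) + cmod (f z - G j z)"
        by (metis norm_minus_commute norm_triangle_sub)
      then have "(cmod (G j z))\<^sup>2 \<le> (cmod (f z) + cmod (f z - G j z))\<^sup>2"
        by (intro power_mono) auto
      also have "\<dots> \<le> 2 * (cmod (f z))\<^sup>2 + 2 * (cmod (f z - G j z))\<^sup>2"
        using sum_squares_bound[of "cmod (f z)" "cmod (f z - G j z)"] by (simp add: power2_sum)
      finally have "(cmod (G j z))\<^sup>2 * w z \<le> (2 * (cmod (f z))\<^sup>2 + 2 * (cmod (f z - G j z))\<^sup>2) * w z"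
        by (intro mult_right_mono) auto
      then show ?thesis by (simp add: algebra_simps)
    qed
    have "sqnorm (G j) \<le> (LINT z|area_measure. 2 * ((cmod (f z))\<^sup>2 * w z) + 2 * ((cmod (f z - G j z))\<^sup>2 * w z))"
      unfolding sqnorm_def
      by (intro integral_mono pt Bochner_Integration.integrable_add integrable_mult_right L2_D(2) f gj diff_L2 G)
    also have "\<dots> = 2 * sqnorm f + 2 * sqnorm (\<lambda>z. f z - G j z)"
      using L2_D(2)[OF f] L2_D(2)[OF diff_L2[OF G(1)[of j]]] by (simp add: sqnorm_def)
    also have "sqnorm (\<lambda>z. f z - G j z) \<le> d + 1"
    proof -
      have "1 / real (Suc j) \<le> 1" by simp
      then show ?thesis using G(2)[of j] by linarith
    qed
    finally show ?thesis by simp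
  qed
  have loc_bd: "\<exists>B. \<forall>h\<in>range G. \<forall>z\<in>K. norm (h z) \<le> B" if K: "compact K" for K
  proof -
    obtain R where R: "K \<subseteq> cball 0 R" using compact_imp_bounded[OF K] bounded_subset_ballD[of K 0] ball_subset_cball by blast
    obtain M where M: "\<forall>z\<in>cball 0 (R + 1). \<psi> z \<le> M" using weight_bounded_on_cball by blast
    have "cmod (G j z) \<le> 1 + exp (2 * M) * (2 * sqnorm f + 2 * (d + 1))" if "z \<in> K" for j z
    proof -
      have "cball z 1 \<subseteq> cball 0 (R + 1)"
        using R that by (auto simp: dist_norm) (smt (verit) norm_triangle_sub norm_minus_commute subsetD mem_cball_0)
      then have "cmod (G j z) \<le> 1 + exp (2 * M) * sqnorm (G j)"
        using Fock_local_bound[OF G(1), of z M j] M by blast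
      also have "exp (2 * M) * sqnorm (G j) \<le> exp (2 * M) * (2 * sqnorm f + 2 * (d + 1))"
        by (intro mult_left_mono G_sqnorm) simp
      finally show ?thesis by simp
    qed
    then show ?thesis by auto
  qed
  have "\<exists>g r. g holomorphic_on UNIV \<and> strict_mono (r :: nat \<Rightarrow> nat) \<and> (\<forall>x. (\<lambda>n. G (r n) x) \<longlonglongrightarrow> g x)"
  proof (rule Montel[of UNIV "range G" G])
    show "h holomorphic_on UNIV" if "h \<in> range G" for h
      using that Fock_D(1) G(1) by auto
    show "\<exists>B. \<forall>h\<in>range G. \<forall>z\<in>K. cmod (h z) \<le> B" if "compact K" "K \<subseteq> UNIV" for K
      using that(1) by (rule loc_bd)
  qed auto
  then obtain g r where g: "g holomorphic_on UNIV" and r: "strict_mono (r :: nat \<Rightarrow> nat)"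
    and lim: "\<And>x. (\<lambda>n. G (r n) x) \<longlonglongrightarrow> g x"
    by blast
  have [measurable]: "f \<in> borel_measurable borel" using L2_D(1) f by blast
  have [measurable]: "G j \<in> borel_measurable borel" for j using L2_D(1) Fock_D(2) G(1) by blast
  have g_m [measurable]: "g \<in> borel_measurable borel"
    by (rule borel_measurable_continuous_onI[OF holomorphic_on_imp_continuous_on[OF g]])
  \<comment> \<open>The squared distances are kept in \<open>ennreal\<close>, so that Fatou's lemma
    applies before the limit is known to be integrable.\<close>
  define u where "u n z = ennreal ((cmod (f z - G (r n) z))\<^sup>2 * w z)" for n z
  have liminf_u: "liminf (\<lambda>n. u n z) = ennreal ((cmod (f z - g z))\<^sup>2 * w z)" for z
    unfolding u_def by (rule lim_imp_Liminf) (auto intro!: tendsto_intros lim)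
  have int_u: "(\<integral>\<^sup>+z. u n z \<partial>area_measure) = ennreal (sqnorm (\<lambda>z. f z - G (r n) z))" for n
    unfolding u_def sqnorm_def
    by (rule nn_integral_eq_integral[OF L2_D(2)[OF diff_L2[OF G(1)]]]) auto
  have "(\<integral>\<^sup>+z. ennreal ((cmod (f z - g z))\<^sup>2 * w z) \<partial>area_measure) = (\<integral>\<^sup>+z. liminf (\<lambda>n. u n z) \<partial>area_measure)"
    by (simp add: liminf_u)
  also have "\<dots> \<le> liminf (\<lambda>n. \<integral>\<^sup>+z. u n z \<partial>area_measure)"
    by (rule nn_integral_liminf) (simp add: u_def)
  also have "\<dots> \<le> liminf (\<lambda>n. ennreal (d + 1 / real (Suc (r n))))"
    unfolding int_u using G(2) by (intro Liminf_mono always_eventually allI ennreal_leI less_imp_le)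
  also have "\<dots> = ennreal d"
  proof (rule lim_imp_Liminf)
    have "(\<lambda>n. d + 1 / real (Suc n)) \<longlonglongrightarrow> d + 0"
      by (intro tendsto_intros LIMSEQ_Suc lim_1_over_n)
    from LIMSEQ_subseq_LIMSEQ[OF this r]
    have "(\<lambda>n. d + 1 / real (Suc (r n))) \<longlonglongrightarrow> d" by (simp add: comp_def)
    then show "(\<lambda>n. ennreal (d + 1 / real (Suc (r n)))) \<longlonglongrightarrow> ennreal d"
      by (rule tendsto_ennrealI)
  qed simp
  finally have fatou: "(\<integral>\<^sup>+z. ennreal ((cmod (f z - g z))\<^sup>2 * w z) \<partial>area_measure) \<le> ennreal d" .
  have int_fg: "integrable area_measure (\<lambda>z. (cmod (f z - g z))\<^sup>2 * w z)"
  proof (rule integrableI_nonneg)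
    show "(\<integral>\<^sup>+z. ennreal ((cmod (f z - g z))\<^sup>2 * w z) \<partial>area_measure) < \<infinity>"
      using fatou by (rule le_less_trans) simp
  qed auto
  then have fg: "(\<lambda>z. f z - g z) \<in> L2" by (simp add: weighted_Lp_2_iff)
  then have "g \<in> Fock" using L2_diff_mult[OF f fg, of 1] g by (simp add: fock_space_def)
  moreover have "sqnorm (\<lambda>z. f z - g z) \<le> d"
  proof -
    \<comment> \<open>Since \<open>ennreal\<close> truncates negative numbers to 0, this is what
      lets the inequality be read back in the reals.\<close>
    have "0 \<le> d" unfolding d_def using D_ne by (intro cInf_greatest) (auto simp: D_def sqnorm_nonneg)
    moreover have "ennreal (sqnorm (\<lambda>z. f z - g z)) \<le> ennreal d"
      using fatou nn_integral_eq_integral[OF int_fg] by (simp add: sqnorm_def)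
    ultimately show ?thesis by simp
  qed
  ultimately show ?thesis using d_le by (meson order_trans)
qed

lemma exists_orthogonal_in_Fock:
  assumes f: "f \<in> L2"
  shows "\<exists>g\<in>Fock. \<forall>h\<in>Fock. inner2 (\<lambda>z. f z - g z) h = 0"
proof -
  obtain g where g: "g \<in> Fock"
    and min: "\<And>h. h \<in> Fock \<Longrightarrow> sqnorm (\<lambda>z. f z - g z) \<le> sqnorm (\<lambda>z. f z - h z)"
    using exists_nearest_in_Fock[OF f] by blast
  have fg: "(\<lambda>z. f z - g z) \<in> L2" using L2_diff_mult[OF f Fock_D(2)[OF g], of 1] by simp
  have "inner2 (\<lambda>z. f z - g z) h = 0" if h: "h \<in> Fock" for h
  proof -
    define c where "c = inner2 (\<lambda>z. f z - g z) h"
    \<comment> \<open>The quadratic in the step length is smallest at \<open>1 / sqnorm h\<close>;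
      adding 1 to the denominator keeps \<open>t\<close> meaningful when \<open>h\<close> has norm
      0, and \<open>t * sqnorm h \<le> 1\<close> still suffices.\<close>
    define t where "t = 1 / (sqnorm h + 1)"
    have t: "0 < t" "t * sqnorm h \<le> 1"
      using sqnorm_nonneg[of h] by (auto simp: t_def divide_simps)
    have "(\<lambda>z. g z - (- (of_real t * c)) * h z) \<in> Fock" by (rule Fock_diff_mult[OF g h])
    from min[OF this] have "sqnorm (\<lambda>z. f z - g z) \<le> sqnorm (\<lambda>z. (f z - g z) - (of_real t * c) * h z)"
      by (simp add: algebra_simps)
    also have "\<dots> = sqnorm (\<lambda>z. f z - g z) - 2 * Re (cnj (of_real t * c) * c) + (cmod (of_real t * c))\<^sup>2 * sqnorm h"
      unfolding c_def by (rule sqnorm_diff_mult[OF fg Fock_D(2)[OF h]])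
    also have "Re (cnj (of_real t * c) * c) = t * (cmod c)\<^sup>2"
      unfolding cmod_power2 by (simp add: power2_eq_square algebra_simps)
    also have "(cmod (of_real t * c))\<^sup>2 * sqnorm h = t * (cmod c)\<^sup>2 * (t * sqnorm h)"
      by (simp add: norm_mult power_mult_distrib power2_eq_square)
    finally have "2 * (t * (cmod c)\<^sup>2) \<le> t * (cmod c)\<^sup>2 * (t * sqnorm h)" by simp
    also have "\<dots> \<le> t * (cmod c)\<^sup>2 * 1" using t by (intro mult_left_mono) auto
    finally have "t * (cmod c)\<^sup>2 \<le> 0" by simp
    then show ?thesis using t(1) by (simp add: c_def mult_le_0_iff)
  qed
  then show ?thesis using g by blast
qed

text \<open>Orthogonality of \<open>f - g\<close> to \<open>g\<close> gives Pythagoras: the squared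
  norm of \<open>f - g\<close> is \<open>sqnorm f - sqnorm g\<close>, and it is nonnegative.\<close>

lemma bergman_projection_contraction:
  assumes f: "f \<in> L2"
  shows "bergman_projection \<psi> f \<in> L2" "sqnorm (bergman_projection \<psi> f) \<le> sqnorm f"
proof -
  obtain g where g: "g \<in> Fock" and orth: "\<And>h. h \<in> Fock \<Longrightarrow> inner2 (\<lambda>z. f z - g z) h = 0"
    using exists_orthogonal_in_Fock[OF f] by blast
  have eq: "bergman_projection \<psi> f = g" by (rule bergman_projection_eqI[OF f g orth])
  have g2: "g \<in> L2" using g by (rule Fock_D)
  then show "bergman_projection \<psi> f \<in> L2" by (simp add: eq)
  have "inner2 f g = of_real (sqnorm g)"
    using orth[OF g] inner2_diff_left[OF f g2 g2] by (simp add: inner2_self)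
  then have "sqnorm (\<lambda>z. f z - 1 * g z) = sqnorm f - sqnorm g"
    by (subst sqnorm_diff_mult[OF f g2]) simp
  then show "sqnorm (bergman_projection \<psi> f) \<le> sqnorm f"
    using sqnorm_nonneg[of "\<lambda>z. f z - 1 * g z"] by (simp add: eq)
qed

lemma bergman_bounded_2: "bergman_bounded 2 \<psi>"
proof -
  have norm_eq: "weighted_Lp_norm 2 \<psi> f = sqrt (sqnorm f)" for f
    using sqnorm_nonneg[of f] by (simp add: weighted_Lp_norm_def sqnorm_def powr_half_sqrt)
  show ?thesis
    unfolding bergman_bounded_def
    by (rule exI[of _ 1]) (auto simp: norm_eq bergman_projection_contraction)
qed

end

section \<open>Mass distribution of monomials for radial weights\<close>

text \<open>Factor \<open>Suc m\<close> out of \<open>1 + r\<close> and compare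
  \<open>(1 + r / k) ^ k\<close> with \<open>exp r\<close> for \<open>k = Suc m\<close>, which is
  never 0.\<close>

lemma power_one_plus_le_exp:
  fixes r :: real
  assumes "0 \<le> r"
  shows "(1 + r) ^ Suc m \<le> real (Suc m) ^ Suc m * exp r"
proof -
  have "1 + r \<le> real (Suc m) * (1 + r / real (Suc m))"
    by (simp add: field_simps)
  then have "(1 + r) ^ Suc m \<le> (real (Suc m) * (1 + r / real (Suc m))) ^ Suc m"
    using assms by (intro power_mono) auto
  also have "\<dots> = real (Suc m) ^ Suc m * (1 + r / real (Suc m)) ^ Suc m"
    by (rule power_mult_distrib)
  also have "\<dots> \<le> real (Suc m) ^ Suc m * exp r"
    using assms by (intro mult_left_mono exp_ge_one_plus_x_over_n_power_n) auto
  finally show ?thesis .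
qed

text \<open>A layered majorant takes the place of polar coordinates: the disc of radius
  \<open>k + 1\<close> gets height \<open>K / (k + 1) ^ 4\<close>. Its area is
  \<open>(k + 1) ^ 2\<close>, so the total is a constant times the sum of inverse squares.\<close>

lemma integrable_area_measure_decay:
  fixes f :: "complex \<Rightarrow> real"
  assumes [measurable]: "f \<in> borel_measurable borel"
    and nonneg: "\<And>z. 0 \<le> f z" and le: "\<And>z. f z \<le> K / (1 + cmod z) ^ 4"
  shows "integrable area_measure f"
proof (rule integrableI_nonneg)
  have "0 \<le> K / (1 + cmod 0) ^ 4" using nonneg[of 0] le[of 0] by linarith
  then have K: "0 \<le> K" by simp
  define t where "t k z = ennreal (K / real (Suc k) ^ 4) * indicator (ball 0 (real (Suc k))) z" for k and z :: complex
  have pt: "ennreal (f z) \<le> (\<Sum>k. t k z)" for z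
  proof -
    define k where "k = nat \<lfloor>cmod z\<rfloor>"
    have k: "real k \<le> cmod z" "cmod z < real (Suc k)" by (auto simp: k_def) linarith+
    have "f z \<le> K / (1 + cmod z) ^ 4" by (rule le)
    also have "\<dots> \<le> K / real (Suc k) ^ 4"
      using k K by (intro divide_left_mono power_mono mult_pos_pos zero_less_power) auto
    finally have "ennreal (f z) \<le> t k z" using k by (simp add: t_def ennreal_leI)
    also have "\<dots> = (\<Sum>j\<in>{k}. t j z)" by simp
    also have "\<dots> \<le> (\<Sum>k. t k z)" by (intro sum_le_suminf) auto
    finally show ?thesis .
  qed
  have "(\<integral>\<^sup>+z. ennreal (f z) \<partial>area_measure) \<le> (\<integral>\<^sup>+z. (\<Sum>k. t k z) \<partial>area_measure)"
    by (intro nn_integral_mono pt)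
  also have "\<dots> = (\<Sum>k. \<integral>\<^sup>+z. t k z \<partial>area_measure)"
    unfolding t_def
    by (intro nn_integral_suminf borel_measurable_times_ennreal borel_measurable_const borel_measurable_indicator) simp
  also have "\<dots> = (\<Sum>k. ennreal (K * (1 / real (Suc k) ^ 2)))"
  proof (intro arg_cong[where f = suminf] ext)
    fix k
    have "(\<integral>\<^sup>+z. t k z \<partial>area_measure) = ennreal (K / real (Suc k) ^ 4) * ennreal (real (Suc k) ^ 2)"
      unfolding t_def by (subst nn_integral_cmult_indicator) (auto simp: emeasure_area_measure_ball simp del: of_nat_Suc)
    also have "\<dots> = ennreal (K / real (Suc k) ^ 4 * real (Suc k) ^ 2)"
      using K by (simp add: ennreal_mult'[symmetric])
    also have "K / real (Suc k) ^ 4 * real (Suc k) ^ 2 = K * (1 / real (Suc k) ^ 2)"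
      by (simp add: field_simps power2_eq_square power4_eq_xxxx del: of_nat_Suc)
    finally show "(\<integral>\<^sup>+z. t k z \<partial>area_measure) = ennreal (K * (1 / real (Suc k) ^ 2))" .
  qed
  also have "\<dots> < \<infinity>"
  proof -
    have "summable (\<lambda>k. 1 / real (Suc k) ^ 2)"
      using inverse_squares_sums sums_summable by (auto simp: add.commute)
    then have "(\<Sum>k. ennreal (K * (1 / real (Suc k) ^ 2))) \<noteq> top"
      using K by (intro ennreal_suminf_neq_top summable_mult) auto
    then show ?thesis by (simp add: less_top)
  qed
  finally show "(\<integral>\<^sup>+z. ennreal (f z) \<partial>area_measure) < \<infinity>" .
qed (auto simp: nonneg)

text \<open>\<open>\<phi>1\<close> and \<open>\<phi>2\<close> stand for the first two derivatives.
  Differentiation is required at positive radii, where the derivative within the half-line is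
  two-sided; \<open>lim2\<close> is the growth condition for second derivatives.\<close>

locale radial_weight =
  fixes \<phi> \<phi>1 \<phi>2 :: "real \<Rightarrow> real"
  assumes nonneg: "\<And>r. 0 \<le> r \<Longrightarrow> 0 \<le> \<phi> r"
    and cont: "continuous_on {0..} \<phi>"
    and cont1: "continuous_on {0..} \<phi>1"
    and deriv1: "\<And>r. 0 < r \<Longrightarrow> (\<phi> has_real_derivative \<phi>1 r) (at r)"
    and deriv2: "\<And>r. 0 < r \<Longrightarrow> (\<phi>1 has_real_derivative \<phi>2 r) (at r)"
    and pos1: "\<And>r. 0 \<le> r \<Longrightarrow> 0 < \<phi>1 r"
    and lim1: "filterlim \<phi>1 at_top at_top"
    and lim2: "((\<lambda>r. \<phi>2 r / \<phi>1 r ^ 2) \<longlongrightarrow> 0) at_top"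
begin

sublocale continuous_weight "\<lambda>z. \<phi> (cmod z)"
  by standard (auto intro!: continuous_on_compose2[OF cont] continuous_intros)

text \<open>Once \<open>\<phi>1\<close> exceeds 1, the function \<open>\<phi> x - x\<close> is
  nondecreasing; before that point \<open>r - R\<close> is negative and nonnegativity of
  \<open>\<phi>\<close> suffices.\<close>

lemma linear_lower_bound: "\<exists>R. \<forall>r\<ge>0. r - R \<le> \<phi> r"
proof -
  have "\<forall>\<^sub>F r in at_top. 1 \<le> \<phi>1 r" using lim1 by (simp add: filterlim_at_top)
  then obtain R0 where R0: "\<And>r. R0 \<le> r \<Longrightarrow> 1 \<le> \<phi>1 r" by (auto simp: eventually_at_top_linorder)
  define R where "R = max R0 1"
  have "r - R \<le> \<phi> r" if "0 \<le> r" for r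
  proof (cases "R \<le> r")
    case True
    have "\<phi> R - R \<le> \<phi> r - r"
    proof (rule DERIV_nonneg_imp_nondecreasing[OF True])
      fix x assume x: "R \<le> x" "x \<le> r"
      have "((\<lambda>x. \<phi> x - x) has_real_derivative (\<phi>1 x - 1)) (at x)"
        using x by (intro derivative_intros deriv1) (auto simp: R_def)
      then show "\<exists>y. ((\<lambda>x. \<phi> x - x) has_real_derivative y) (at x) \<and> 0 \<le> y"
        using R0[of x] x by (auto simp: R_def)
    qed
    moreover have "0 \<le> \<phi> R" by (rule nonneg) (simp add: R_def)
    ultimately show ?thesis by linarith
  next
    case False
    then show ?thesis using nonneg[OF that] by linarith
  qed
  then show ?thesis by blast
qed

text \<open>The linear lower bound yields decay like \<open>exp (- 2 * r)\<close>, and the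
  polynomial costs only one factor \<open>exp r\<close>.\<close>

lemma polynomial_decay: "\<exists>K. \<forall>r\<ge>0. (1 + r) ^ m * exp (- 2 * \<phi> r) \<le> K"
proof -
  obtain R where R: "\<And>r. 0 \<le> r \<Longrightarrow> r - R \<le> \<phi> r" using linear_lower_bound by blast
  have "(1 + r) ^ m * exp (- 2 * \<phi> r) \<le> real (Suc m) ^ Suc m * exp (2 * R)" if r: "0 \<le> r" for r
  proof -
    have "(1 + r) ^ m \<le> (1 + r) ^ Suc m" using r by (intro power_increasing) auto
    also have "\<dots> \<le> real (Suc m) ^ Suc m * exp r" by (rule power_one_plus_le_exp[OF r])
    finally have "(1 + r) ^ m * exp (- 2 * \<phi> r) \<le> (real (Suc m) ^ Suc m * exp r) * exp (2 * R - 2 * r)"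
      using R[OF r] r by (intro mult_mono) auto
    also have "\<dots> = real (Suc m) ^ Suc m * exp (2 * R - r)"
      by (simp add: exp_add[symmetric] mult.assoc)
    also have "\<dots> \<le> real (Suc m) ^ Suc m * exp (2 * R)" using r by (intro mult_left_mono) auto
    finally show ?thesis .
  qed
  then show ?thesis by blast
qed

text \<open>\<open>dens n\<close> is the integrand of the squared L2 norm of the monomial
  \<open>z ^ n\<close>. The quantity \<open>mass n S\<close> below is therefore the squared norm of
  that monomial restricted to \<open>S\<close>.\<close>

definition dens :: "nat \<Rightarrow> complex \<Rightarrow> real" where
  "dens n z = cmod z ^ (2 * n) * exp (- 2 * \<phi> (cmod z))"

definition mass :: "nat \<Rightarrow> complex set \<Rightarrow> real" where
  "mass n S = (LINT z|area_measure. indicator S z * dens n z)"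

lemma dens_nonneg: "0 \<le> dens n z"
  by (simp add: dens_def)

lemma dens_measurable [measurable]: "dens n \<in> borel_measurable borel"
  using weight_measurable unfolding dens_def[abs_def] by measurable

text \<open>The power \<open>2 * n + 4\<close> in the decay estimate covers the monomial and the
  four powers demanded by \<open>integrable_area_measure_decay\<close>.\<close>

lemma integrable_dens: "integrable area_measure (dens n)"
proof -
  obtain K where K: "\<And>r. 0 \<le> r \<Longrightarrow> (1 + r) ^ (2 * n + 4) * exp (- 2 * \<phi> r) \<le> K"
    using polynomial_decay by blast
  show ?thesis
  proof (rule integrable_area_measure_decay)
    fix z
    have "dens n z * (1 + cmod z) ^ 4 \<le> (1 + cmod z) ^ (2 * n) * exp (- 2 * \<phi> (cmod z)) * (1 + cmod z) ^ 4"
      unfolding dens_def by (intro mult_right_mono power_mono) auto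
    also have "\<dots> \<le> K" using K[of "cmod z"] by (simp add: power_add mult_ac)
    finally have "dens n z * (1 + cmod z) ^ 4 \<le> K" .
    moreover have "0 < (1 + cmod z) ^ 4" by (intro zero_less_power add_pos_nonneg) auto
    ultimately show "dens n z \<le> K / (1 + cmod z) ^ 4" by (simp add: pos_le_divide_eq)
  qed (auto simp: dens_nonneg)
qed

lemma integrable_indicator_dens:
  assumes "S \<in> sets borel"
  shows "integrable area_measure (\<lambda>z. indicator S z * dens n z)"
  using integrable_mult_indicator[OF _ integrable_dens, of S n] assms by simp

lemma mass_mono:
  assumes "S \<in> sets borel" "T \<in> sets borel" "S \<subseteq> T"
  shows "mass n S \<le> mass n T"
  unfolding mass_def using assms
  by (intro integral_mono integrable_indicator_dens mult_right_mono dens_nonneg) (auto simp: indicator_def)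

lemma mass_Un:
  assumes "S \<in> sets borel" "T \<in> sets borel" "S \<inter> T = {}"
  shows "mass n (S \<union> T) = mass n S + mass n T"
proof -
  have "indicat_real (S \<union> T) z * dens n z = indicat_real S z * dens n z + indicat_real T z * dens n z" for z
    using assms(3) by (auto simp: indicator_def)
  then show ?thesis
    unfolding mass_def using assms by (simp add: integrable_indicator_dens)
qed

lemma mass_le:
  assumes "S \<in> sets borel" "emeasure area_measure S < \<infinity>" "\<And>z. z \<in> S \<Longrightarrow> dens n z \<le> c"
  shows "mass n S \<le> c * measure area_measure S"
proof -
  have "integrable area_measure (\<lambda>z. c * indicat_real S z)"
    using assms by (intro integrable_mult_right integrable_real_indicator) auto
  then have "mass n S \<le> (LINT z|area_measure. c * indicat_real S z)"
    unfolding mass_def using assms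
    by (intro integral_mono integrable_indicator_dens) (auto simp: indicator_def)
  then show ?thesis using assms by simp
qed

lemma mass_ge:
  assumes "S \<in> sets borel" "emeasure area_measure S < \<infinity>" "\<And>z. z \<in> S \<Longrightarrow> c \<le> dens n z"
  shows "c * measure area_measure S \<le> mass n S"
proof -
  have "integrable area_measure (\<lambda>z. c * indicat_real S z)"
    using assms by (intro integrable_mult_right integrable_real_indicator) auto
  then have "(LINT z|area_measure. c * indicat_real S z) \<le> mass n S"
    unfolding mass_def using assms
    by (intro integral_mono integrable_indicator_dens) (auto simp: indicator_def)
  then show ?thesis using assms by simp
qed

section \<open>Annuli and the peak of the radial density\<close>

definition annulus :: "real \<Rightarrow> real \<Rightarrow> complex set" where
  "annulus a b = {z. a \<le> cmod z \<and> cmod z < b}"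

lemma annulus_eq: "annulus a b = ball 0 b - ball 0 a"
  by (auto simp: annulus_def)

lemma annulus_sets [measurable, simp]: "annulus a b \<in> sets borel"
  by (simp add: annulus_eq)

lemma emeasure_annulus_finite: "0 \<le> b \<Longrightarrow> emeasure area_measure (annulus a b) < \<infinity>"
  using emeasure_mono[of "annulus a b" "ball 0 b" area_measure] emeasure_area_measure_ball[of b 0]
  by (auto simp: annulus_eq) (metis ennreal_less_top le_less_trans)

lemma measure_annulus:
  assumes "0 \<le> a" "a \<le> b"
  shows "measure area_measure (annulus a b) = b\<^sup>2 - a\<^sup>2"
  unfolding annulus_eq using assms
  by (subst measure_Diff) (auto simp: measure_area_measure_ball emeasure_area_measure_ball)

text \<open>The density of \<open>mass n\<close> with respect to \<open>dr/r\<close>, up to a constant factor.\<close>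

definition peak :: "nat \<Rightarrow> real \<Rightarrow> real" where
  "peak n r = r ^ (2 * n + 2) * exp (- 2 * \<phi> r)"

lemma peak_dens: "peak n (cmod z) = (cmod z)\<^sup>2 * dens n z"
  by (simp add: peak_def dens_def power_add mult_ac power2_eq_square)

lemma peak_eq_exp:
  assumes "0 < r"
  shows "peak n r = exp (2 * (real n + 1) * ln r - 2 * \<phi> r)"
proof -
  have "r ^ (2 * n + 2) = exp (real (2 * n + 2) * ln r)"
    using assms by (simp only: exp_of_nat_mult exp_ln)
  also have "real (2 * n + 2) = 2 * (real n + 1)" by simp
  finally show ?thesis by (simp add: peak_def exp_diff exp_minus divide_inverse)
qed

text \<open>The decay estimate is taken with one power more than \<open>peak\<close> contains, so
  \<open>peak n r * (1 + r) \<le> K\<close>. Beyond \<open>R\<close> the value thus stays below that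
  at 1, and the maximum over the compact interval is global. It is not at 0, where
  \<open>peak\<close> vanishes.\<close>

lemma peak_max: "\<exists>r0>0. \<forall>r\<ge>0. peak n r \<le> peak n r0"
proof -
  obtain K where K: "\<And>r. 0 \<le> r \<Longrightarrow> (1 + r) ^ (2 * n + 3) * exp (- 2 * \<phi> r) \<le> K"
    using polynomial_decay by blast
  have p1: "0 < peak n 1" by (simp add: peak_def)
  define R where "R = max 1 (K / peak n 1)"
  have cont_peak: "continuous_on {0..R} (peak n)"
    unfolding peak_def[abs_def]
    by (intro continuous_intros continuous_on_subset[OF cont]) auto
  have "{0..R} \<noteq> {}" by (simp add: R_def)
  then obtain r0 where r0: "r0 \<in> {0..R}" "\<And>r. r \<in> {0..R} \<Longrightarrow> peak n r \<le> peak n r0"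
    using continuous_attains_sup[OF compact_Icc _ cont_peak] by blast
  have ge1: "peak n 1 \<le> peak n r0" using r0(2)[of 1] by (simp add: R_def)
  have "r0 \<noteq> 0" using ge1 p1 by (auto simp: peak_def)
  then have "0 < r0" using r0(1) by simp
  moreover have "peak n r \<le> peak n r0" if r: "0 \<le> r" for r
  proof (cases "r \<le> R")
    case False
    have "peak n r * (1 + r) \<le> ((1 + r) ^ (2 * n + 2) * exp (- 2 * \<phi> r)) * (1 + r)"
      unfolding peak_def using r by (intro mult_right_mono power_mono) auto
    also have "\<dots> \<le> K" using K[OF r] by (simp add: power_add power2_eq_square power3_eq_cube mult_ac)
    also have "K \<le> peak n 1 * (1 + r)"
    proof -
      have "K / peak n 1 \<le> 1 + r" using False by (simp add: R_def)
      then show ?thesis using p1 by (simp add: field_simps)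
    qed
    finally have "peak n r \<le> peak n 1" using r by simp
    then show ?thesis using ge1 by simp
  qed (use r0 r in auto)
  ultimately show ?thesis by blast
qed

text \<open>The derivative of the logarithm of \<open>peak\<close> vanishes at the maximum. The
  neighbourhood of radius \<open>r0\<close> contains only positive arguments, where
  \<open>peak_eq_exp\<close> holds.\<close>

lemma peak_critical:
  assumes r0: "0 < r0" and max: "\<And>r. 0 \<le> r \<Longrightarrow> peak n r \<le> peak n r0"
  shows "r0 * \<phi>1 r0 = real n + 1"
proof -
  define L where "L r = 2 * (real n + 1) * ln r - 2 * \<phi> r" for r
  have "(L has_real_derivative 2 * (real n + 1) * (1 / r0) - 2 * \<phi>1 r0) (at r0)"
    unfolding L_def[abs_def] using r0
    by (auto intro!: derivative_eq_intros deriv1)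
  moreover have "\<forall>y. \<bar>r0 - y\<bar> < r0 \<longrightarrow> L y \<le> L r0"
  proof (intro allI impI)
    fix y assume "\<bar>r0 - y\<bar> < r0"
    then have "0 < y" by linarith
    then show "L y \<le> L r0" using max[of y] r0 by (simp add: peak_eq_exp L_def)
  qed
  ultimately have "2 * (real n + 1) * (1 / r0) - 2 * \<phi>1 r0 = 0"
    by (rule DERIV_local_max[OF _ r0])
  then show ?thesis using r0 by (simp add: field_simps)
qed

text \<open>At the maximum, \<open>1/\<phi>1\<close> equals \<open>r0/(n+1)\<close>; its derivative is eventually \<open>\<ge> -\<delta>\<close>, hence
  \<open>\<phi>1\<close> hardly grows over a distance comparable to \<open>r0/(n+1)\<close> and the peak is flat there.\<close>

lemma peak_flat:
  assumes B: "0 < B"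
  shows "\<forall>\<^sub>F n in sequentially. \<forall>r0 r. 0 < r0 \<longrightarrow> (\<forall>r\<ge>0. peak n r \<le> peak n r0) \<longrightarrow>
     r0 \<le> r \<longrightarrow> r \<le> r0 * (1 + B / (real n + 1)) \<longrightarrow> peak n r0 / 3 \<le> peak n r"
proof -
  \<comment> \<open>The bound on \<open>\<delta> * B\<close> keeps
    \<open>q = 1 - \<delta> * B\<close> above 1/2, and the bound on \<open>\<delta> * B^2\<close>
    limits the excess growth of \<open>\<phi>\<close> to 1/4.\<close>
  define \<delta> where "\<delta> = 1 / (8 * B\<^sup>2 + 2 * B)"
  have \<delta>: "0 < \<delta>" "\<delta> * B \<le> 1 / 2" "\<delta> * B\<^sup>2 \<le> 1 / 8"
    using B by (auto simp: \<delta>_def field_simps power2_eq_square add_pos_pos)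
  have "\<forall>\<^sub>F r in at_top. \<phi>2 r / \<phi>1 r ^ 2 < \<delta>" using order_tendstoD(2)[OF lim2 \<delta>(1)] .
  then obtain R0 where R0: "\<And>r. R0 \<le> r \<Longrightarrow> \<phi>2 r / \<phi>1 r ^ 2 < \<delta>"
    by (auto simp: eventually_at_top_linorder)
  define R where "R = max R0 1"
  have "compact (\<phi>1 ` {0..R})"
    by (intro compact_continuous_image continuous_on_subset[OF cont1]) auto
  then have "bdd_above (\<phi>1 ` {0..R})"
    by (intro bounded_imp_bdd_above compact_imp_bounded)
  then obtain M where M: "\<And>r. r \<in> {0..R} \<Longrightarrow> \<phi>1 r \<le> M"
    unfolding bdd_above_def by blast
  \<comment> \<open>The term \<open>R * M\<close> forces \<open>r0 \<ge> R\<close>, since below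
    \<open>R\<close> the product \<open>r0 * \<phi>1 r0\<close> could not reach
    \<open>n + 1\<close>. The term \<open>B\<close> makes the relative distance \<open>x\<close> at
    most 1, and \<open>16 * B^2\<close> makes the second-order term of the logarithm at most
    1/16.\<close>
  have "\<forall>\<^sub>F n in sequentially. R * M + B + 16 * B\<^sup>2 < real n"
    using filterlim_real_sequentially by (simp add: filterlim_at_top_dense)
  then show ?thesis
  proof eventually_elim
    case (elim n)
    have R: "0 < R" by (simp add: R_def)
    then have RM: "0 \<le> R * M" using M[of 0] pos1[of 0] by simp
    define m where "m = real n + 1"
    have B2: "0 \<le> 16 * B\<^sup>2" by simp
    have m: "0 < m" "R * M < m" "B \<le> m" "16 * B\<^sup>2 \<le> m"
      unfolding m_def using elim B RM B2 by linarith+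
    show ?case
    proof (intro allI impI)
      fix r0 r
      assume r0: "0 < r0" and max: "\<forall>r\<ge>0. peak n r \<le> peak n r0"
        and r: "r0 \<le> r" "r \<le> r0 * (1 + B / (real n + 1))"
      have crit: "r0 * \<phi>1 r0 = m" using peak_critical[OF r0] max by (simp add: m_def)
      have r0R: "R \<le> r0"
      proof (rule ccontr)
        assume "\<not> R \<le> r0"
        then have "r0 * \<phi>1 r0 \<le> R * M" using r0 M[of r0] pos1[of r0] by (intro mult_mono) (auto simp: R_def)
        then show False using crit m by simp
      qed
      define x where "x = r / r0 - 1"
      have rx: "r = r0 * (1 + x)" using r0 by (simp add: x_def)
      have x: "0 \<le> x" "x \<le> B / m"
        using r r0 unfolding rx by (auto simp: m_def)
      have x1: "x \<le> 1" using x m by (smt (verit) divide_le_eq_1)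
      define q where "q = 1 - \<delta> * B"
      have q: "1 / 2 \<le> q" "q \<le> 1" using \<delta> B by (auto simp: q_def)
      have \<phi>1_le: "\<phi>1 y \<le> m / (r0 * q)" if y: "r0 \<le> y" "y \<le> r" for y
      proof -
        \<comment> \<open>The derivative of \<open>1 / \<phi>1\<close> is
          \<open>- \<phi>2 / \<phi>1^2\<close>, which exceeds \<open>- \<delta>\<close> beyond
          \<open>R\<close>. The starting value \<open>1 / \<phi>1 r0\<close> is
          \<open>r0 / m\<close> by criticality.\<close>
        have "1 / \<phi>1 r0 + \<delta> * r0 \<le> 1 / \<phi>1 y + \<delta> * y"
        proof (rule DERIV_nonneg_imp_nondecreasing[OF y(1)])
          fix u assume u: "r0 \<le> u" "u \<le> y"
          then have u0: "0 < u" using r0 by linarith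
          have p: "0 < \<phi>1 u" using pos1 u0 by simp
          have "((\<lambda>u. 1 / \<phi>1 u + \<delta> * u) has_real_derivative (\<delta> - \<phi>2 u / \<phi>1 u ^ 2)) (at u)"
            using p by (auto intro!: derivative_eq_intros deriv2[OF u0] simp: power2_eq_square)
          moreover have "0 \<le> \<delta> - \<phi>2 u / \<phi>1 u ^ 2" using R0[of u] u r0R by (simp add: R_def)
          ultimately show "\<exists>d. ((\<lambda>u. 1 / \<phi>1 u + \<delta> * u) has_real_derivative d) (at u) \<and> 0 \<le> d"
            by blast
        qed
        moreover have "1 / \<phi>1 r0 = r0 / m" using r0 by (simp flip: crit)
        moreover have "\<delta> * (y - r0) \<le> \<delta> * (r0 * (B / m))"
        proof (intro mult_left_mono)
          have "y - r0 \<le> r0 * x" using y by (simp add: rx algebra_simps)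
          also have "\<dots> \<le> r0 * (B / m)" using x r0 by (intro mult_left_mono) auto
          finally show "y - r0 \<le> r0 * (B / m)" .
        qed (use \<delta> in auto)
        ultimately have "r0 / m - \<delta> * (r0 * (B / m)) \<le> 1 / \<phi>1 y"
          by (simp add: algebra_simps)
        then have *: "r0 * q / m \<le> 1 / \<phi>1 y" using m by (simp add: q_def field_simps)
        have "0 < \<phi>1 y" using pos1[of y] y r0 by simp
        then have "r0 * q * \<phi>1 y \<le> m" using * m by (simp add: field_simps)
        then show ?thesis using r0 q by (simp add: field_simps)
      qed
      have "\<phi> r - \<phi> r0 \<le> x * m / q"
      proof (cases "r = r0")
        case True
        then show ?thesis using x m q by simp
      next
        case False
        then have "r0 < r" using r by simp
        then obtain y where y: "r0 < y" "y < r" "\<phi> r - \<phi> r0 = (r - r0) * \<phi>1 y"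
          using MVT2[of r0 r \<phi> \<phi>1] deriv1 r0 by (metis less_le_trans)
        have "(r - r0) * \<phi>1 y \<le> (r - r0) * (m / (r0 * q))"
          using \<phi>1_le[of y] y r by (intro mult_left_mono) auto
        also have "\<dots> = x * m / q" using r0 q by (simp add: rx field_simps)
        finally show ?thesis using y(3) by simp
      qed
      \<comment> \<open>This linearises \<open>1 / (1 - t) \<le> 1 + 2 * t\<close> for
        \<open>t = \<delta> * B\<close>, which is at most 1/2.\<close>
      also have "x * m / q \<le> x * m * (1 + 2 * (\<delta> * B))"
      proof -
        have "1 \<le> (1 + 2 * (\<delta> * B)) * q"
        proof -
          have "(\<delta> * B) * (\<delta> * B) \<le> (\<delta> * B) * (1 / 2)" using \<delta> B by (intro mult_left_mono) auto
          then show ?thesis by (simp add: q_def algebra_simps)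
        qed
        then have "1 / q \<le> 1 + 2 * (\<delta> * B)" using q by (simp add: divide_le_eq)
        then have "x * m * (1 / q) \<le> x * m * (1 + 2 * (\<delta> * B))" using x m by (intro mult_left_mono) auto
        then show ?thesis by simp
      qed
      finally have 1: "\<phi> r - \<phi> r0 \<le> x * m + 2 * (\<delta> * B) * (x * m)" by (simp add: algebra_simps)
      have xm: "x * m \<le> B" using x(2) m by (simp add: field_simps)
      have "2 * (\<delta> * B) * (x * m) \<le> 2 * (\<delta> * B) * B" using xm \<delta> B by (intro mult_left_mono) auto
      also have "\<dots> \<le> 1 / 4" using \<delta>(3) by (simp add: power2_eq_square)
      finally have 2: "2 * (\<delta> * B) * (x * m) \<le> 1 / 4" .
      have "x - x\<^sup>2 \<le> ln (1 + x)" by (rule ln_one_plus_pos_lower_bound[OF x(1) x1])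
      then have 3: "m * (x - x\<^sup>2) \<le> m * ln (1 + x)" using m by (intro mult_left_mono) auto
      have 4: "m * x\<^sup>2 \<le> 1 / 16"
      proof -
        have "m * x\<^sup>2 = (x * m) * x" by (simp add: power2_eq_square)
        also have "\<dots> \<le> B * (B / m)" using xm x B m by (intro mult_mono) auto
        also have "\<dots> = B\<^sup>2 / m" by (simp add: power2_eq_square)
        also have "\<dots> \<le> 1 / 16" using m by (simp add: field_simps)
        finally show ?thesis .
      qed
      have ln_r: "ln r = ln r0 + ln (1 + x)" unfolding rx using r0 x by (simp add: ln_mult)
      \<comment> \<open>The first-order terms \<open>x * m\<close> of the logarithm and of
        \<open>\<phi>\<close> cancel. The remaining loss is at most twice \<open>1/16 + 1/4\<close>,
        hence below 1, and \<open>exp 1 \<le> 3\<close> gives the factor 1/3.\<close>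
      have "2 * m * ln r0 - 2 * \<phi> r0 - 1 \<le> 2 * m * ln r - 2 * \<phi> r"
        using 1 2 3 4 unfolding ln_r by (simp add: algebra_simps)
      then have "exp (2 * m * ln r0 - 2 * \<phi> r0 - 1) \<le> peak n r"
        using r0 r by (subst peak_eq_exp) (auto simp: m_def)
      moreover have "exp (2 * m * ln r0 - 2 * \<phi> r0 - 1) = peak n r0 / exp 1"
        using r0 by (simp add: peak_eq_exp exp_diff m_def)
      moreover have "peak n r0 / 3 \<le> peak n r0 / exp 1"
        using exp_le r0 by (intro divide_left_mono) (auto simp: peak_def)
      ultimately show "peak n r0 / 3 \<le> peak n r" by linarith
    qed
  qed
qed

text \<open>On the annulus the density is at most \<open>P / a^2\<close> and the area is
  \<open>a^2 * (s^2 - 1)\<close>, so the bound depends on the ratio of the radii alone.\<close>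

lemma mass_annulus_le:
  assumes a: "0 < a" and s: "1 \<le> s" and max: "\<And>r. 0 \<le> r \<Longrightarrow> peak n r \<le> P"
  shows "mass n (annulus a (a * s)) \<le> P * (s\<^sup>2 - 1)"
proof -
  have P: "0 \<le> P" using max[of 0] by (simp add: peak_def)
  have "mass n (annulus a (a * s)) \<le> P / a\<^sup>2 * measure area_measure (annulus a (a * s))"
  proof (rule mass_le)
    fix z assume z: "z \<in> annulus a (a * s)"
    then have "a\<^sup>2 * dens n z \<le> (cmod z)\<^sup>2 * dens n z"
      using a by (intro mult_right_mono power_mono dens_nonneg) (auto simp: annulus_def)
    also have "\<dots> \<le> P" using max[of "cmod z"] by (simp add: peak_dens)
    finally show "dens n z \<le> P / a\<^sup>2" using a by (simp add: field_simps)
  qed (use a s emeasure_annulus_finite[of "a * s" a] in auto)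
  also have "\<dots> = P * (s\<^sup>2 - 1)"
    using a s by (subst measure_annulus) (auto simp: field_simps power_mult_distrib)
  finally show ?thesis .
qed

text \<open>Here the density is compared at the outer radius \<open>a * s\<close>, so the area is
  divided by \<open>(a * s)^2\<close>.\<close>

lemma mass_annulus_ge:
  assumes a: "0 < a" and s: "1 \<le> s" and min: "\<And>r. a \<le> r \<Longrightarrow> r \<le> a * s \<Longrightarrow> c \<le> peak n r" and c: "0 \<le> c"
  shows "c * (1 - 1 / s\<^sup>2) \<le> mass n (annulus a (a * s))"
proof -
  have "c * (1 - 1 / s\<^sup>2) = c / (a * s)\<^sup>2 * measure area_measure (annulus a (a * s))"
    using a s by (subst measure_annulus) (auto simp: field_simps power_mult_distrib)
  also have "\<dots> \<le> mass n (annulus a (a * s))"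
  proof (rule mass_ge)
    fix z assume z: "z \<in> annulus a (a * s)"
    then have "c \<le> (cmod z)\<^sup>2 * dens n z"
      using min[of "cmod z"] by (simp add: annulus_def peak_dens)
    also have "\<dots> \<le> (a * s)\<^sup>2 * dens n z"
      using a z by (intro mult_right_mono power_mono dens_nonneg) (auto simp: annulus_def)
    finally show "c / (a * s)\<^sup>2 \<le> dens n z" using a s by (simp add: field_simps)
  qed (use a s emeasure_annulus_finite[of "a * s" a] in auto)
  finally show ?thesis .
qed

section \<open>Quantiles of the mass\<close>

lemma mass_split: "mass n UNIV = mass n (ball 0 \<rho>) + mass n (- ball 0 \<rho>)"
  using mass_Un[of "ball 0 \<rho>" "- ball 0 \<rho>" n] by (simp add: Compl_partition)

text \<open>Nonnegativity of \<open>\<phi>\<close> bounds the density by 1 on the unit disc, so the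
  mass is at most the area, and \<open>\<rho> \<le> sqrt T / 3\<close> makes the area at most
  \<open>T / 9\<close>.\<close>

lemma mass_small_ball:
  assumes "0 < T"
  shows "\<exists>\<rho>>0. mass n (ball 0 \<rho>) < T / 4"
proof (intro exI conjI)
  define \<rho> where "\<rho> = min 1 (sqrt T / 3)"
  show \<rho>: "0 < \<rho>" using assms by (simp add: \<rho>_def)
  have "mass n (ball 0 \<rho>) \<le> 1 * measure area_measure (ball 0 \<rho>)"
  proof (rule mass_le)
    fix z :: complex assume "z \<in> ball 0 \<rho>"
    then have "cmod z \<le> 1" by (simp add: \<rho>_def)
    then have "cmod z ^ (2 * n) * exp (- 2 * \<phi> (cmod z)) \<le> 1 * 1"
      using nonneg[of "cmod z"] by (intro mult_mono power_le_one) auto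
    then show "dens n z \<le> 1" by (simp add: dens_def)
  qed (use \<rho> in \<open>auto simp: emeasure_area_measure_ball\<close>)
  also have "\<dots> = \<rho>\<^sup>2" using \<rho> by (simp add: measure_area_measure_ball)
  also have "\<dots> \<le> (sqrt T / 3)\<^sup>2" using \<rho> by (intro power_mono) (auto simp: \<rho>_def)
  also have "\<dots> < T / 4" using assms by (simp add: power_divide)
  finally show "mass n (ball 0 \<rho>) < T / 4" .
qed

text \<open>Chebyshev's inequality: outside radius \<open>\<rho>\<close> the density
  \<open>dens (Suc n)\<close> is at least \<open>\<rho>^2\<close> times \<open>dens n\<close>, and
  its total integral is finite. A tail below three quarters leaves a quarter inside.\<close>

lemma mass_large_ball:
  assumes T: "0 < mass n UNIV"
  shows "\<forall>\<^sub>F \<rho> in at_top. mass n UNIV / 4 \<le> mass n (ball 0 \<rho>)"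
proof -
  have tail: "mass n (- ball 0 \<rho>) \<le> mass (Suc n) UNIV / \<rho>\<^sup>2" if \<rho>: "0 < \<rho>" for \<rho>
  proof -
    have pt: "indicat_real (- ball 0 \<rho>) z * dens n z \<le> 1 / \<rho>\<^sup>2 * (indicat_real UNIV z * dens (Suc n) z)" for z
    proof (cases "z \<in> ball 0 \<rho>")
      case True
      then show ?thesis using dens_nonneg[of "Suc n" z] by simp
    next
      case False
      then have "\<rho>\<^sup>2 * dens n z \<le> (cmod z)\<^sup>2 * dens n z"
        using \<rho> by (intro mult_right_mono power_mono dens_nonneg) auto
      also have "\<dots> = dens (Suc n) z" by (simp add: dens_def power2_eq_square mult_ac)
      finally show ?thesis using False \<rho> by (simp add: field_simps)
    qed
    have "mass n (- ball 0 \<rho>) \<le> (LINT z|area_measure. 1 / \<rho>\<^sup>2 * (indicat_real UNIV z * dens (Suc n) z))"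
      unfolding mass_def
      by (intro integral_mono pt integrable_mult_right integrable_indicator_dens) auto
    then show ?thesis by (simp add: mass_def)
  qed
  have "((\<lambda>\<rho>::real. mass (Suc n) UNIV / \<rho>\<^sup>2) \<longlongrightarrow> 0) at_top"
    by (intro tendsto_divide_0[OF tendsto_const] filterlim_at_top_imp_at_infinity filterlim_pow_at_top filterlim_ident) auto
  then have "\<forall>\<^sub>F \<rho> in at_top. mass (Suc n) UNIV / \<rho>\<^sup>2 < mass n UNIV * (3 / 4)"
    using T by (intro order_tendstoD(2)) auto
  then show ?thesis
    using eventually_gt_at_top[of 0]
  proof eventually_elim
    case (elim \<rho>)
    then show ?case using tail[of \<rho>] mass_split[of n \<rho>] by linarith
  qed
qed

text \<open>A quantile of \<open>mass n\<close> is located on the geometric grid of ratio \<open>s\<close>: no two adjacent cells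
  of the grid carry more than half of the mass.\<close>

lemma mass_spread:
  assumes b: "0 < b"
  shows "\<exists>n\<ge>1. \<exists>\<rho>>0. \<exists>s>1. 1 + b / 2 \<le> s ^ n \<and> 0 < mass n UNIV \<and>
    mass n UNIV / 4 \<le> mass n (ball 0 \<rho>) \<and> mass n UNIV / 4 \<le> mass n (- ball 0 (\<rho> * s))"
proof -
  \<comment> \<open>The flat region gives total mass at least
    \<open>P * B / (6 * m) = 30 * P * b / m\<close>, while two adjacent cells carry at most
    \<open>15 * P * b / m\<close>. The constant 180 makes the second at most half of the
    first.\<close>
  define B where "B = 180 * b"
  have B: "0 < B" using b by (simp add: B_def)
  have "\<forall>\<^sub>F n in sequentially. B \<le> real n"
    using filterlim_real_sequentially by (simp add: filterlim_at_top)
  with peak_flat[OF B] have "\<forall>\<^sub>F n in sequentially. B \<le> real n \<and> 1 \<le> n \<and> (\<forall>r0 r. 0 < r0 \<longrightarrow> (\<forall>r\<ge>0. peak n r \<le> peak n r0) \<longrightarrow>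
     r0 \<le> r \<longrightarrow> r \<le> r0 * (1 + B / (real n + 1)) \<longrightarrow> peak n r0 / 3 \<le> peak n r)"
    using eventually_ge_at_top[of 1] by eventually_elim blast
  then obtain n where n: "B \<le> real n" "1 \<le> n" and
     flat: "\<And>r0 r. 0 < r0 \<Longrightarrow> \<forall>r\<ge>0. peak n r \<le> peak n r0 \<Longrightarrow> r0 \<le> r \<Longrightarrow> r \<le> r0 * (1 + B / (real n + 1)) \<Longrightarrow> peak n r0 / 3 \<le> peak n r"
    unfolding eventually_sequentially by blast
  define m where "m = real n + 1"
  have m: "0 < m" "B \<le> m" "b \<le> m" using n b by (auto simp: m_def B_def)
  obtain r0 where r0: "0 < r0" and max: "\<And>r. 0 \<le> r \<Longrightarrow> peak n r \<le> peak n r0"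
    using peak_max by blast
  define P where "P = peak n r0"
  have P: "0 < P" using r0 by (simp add: P_def peak_def)
  define T where "T = mass n UNIV"
  define \<eta> where "\<eta> = B / m"
  have \<eta>: "0 < \<eta>" "\<eta> \<le> 1" using B m by (auto simp: \<eta>_def)
  \<comment> \<open>On the annulus of ratio \<open>1 + \<eta>\<close> starting at \<open>r0\<close>
    the peak is at least \<open>P / 3\<close>, and \<open>1 - 1 / (1 + \<eta>)^2\<close> is at least
    \<open>\<eta> / 2\<close> because \<open>\<eta> \<le> 1\<close>.\<close>
  have T_ge: "P * \<eta> / 6 \<le> T"
  proof -
    have "\<eta> / 2 \<le> 1 - 1 / (1 + \<eta>)\<^sup>2"
    proof -
      have "\<eta> * \<eta> \<le> 1 * 1" using \<eta> by (intro mult_mono) auto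
      then have "\<eta> * (\<eta> * \<eta>) \<le> \<eta> * 1" using \<eta> by (intro mult_left_mono) auto
      then have "\<eta> * (1 + \<eta>)\<^sup>2 + 2 \<le> 2 * (1 + \<eta>)\<^sup>2"
        using \<eta> by (simp add: power2_eq_square algebra_simps)
      then have "1 \<le> (1 - \<eta> / 2) * (1 + \<eta>)\<^sup>2" by (simp add: algebra_simps)
      then have "1 / (1 + \<eta>)\<^sup>2 \<le> 1 - \<eta> / 2" using \<eta> by (simp add: divide_le_eq)
      then show ?thesis by simp
    qed
    then have "P / 3 * (\<eta> / 2) \<le> P / 3 * (1 - 1 / (1 + \<eta>)\<^sup>2)" using P by (intro mult_left_mono) auto
    also have "\<dots> \<le> mass n (annulus r0 (r0 * (1 + \<eta>)))"
      using r0 \<eta> P flat[OF r0] max by (intro mass_annulus_ge) (auto simp: P_def \<eta>_def m_def)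
    also have "\<dots> \<le> T" unfolding T_def by (intro mass_mono) auto
    finally show ?thesis by simp
  qed
  have T: "0 < T" using T_ge P \<eta> by (smt (verit) divide_pos_pos mult_pos_pos)
  define s where "s = 1 + b / m"
  have s: "1 < s" using b m by (simp add: s_def)
  \<comment> \<open>Two adjacent cells form an annulus of ratio \<open>s^2\<close>, and the mass
    bound squares this ratio. The constant is 4 + 6 + 4 + 1, from the binomial expansion with
    \<open>b / m \<le> 1\<close>.\<close>
  have s4: "s ^ 4 - 1 \<le> 15 * (b / m)"
  proof -
    define x where "x = b / m"
    have x: "0 \<le> x" "x \<le> 1" using b m by (auto simp: x_def)
    have "x ^ 2 \<le> x" "x ^ 3 \<le> x" "x ^ 4 \<le> x"
      using x power_decreasing[of 1 2 x] power_decreasing[of 1 3 x] power_decreasing[of 1 4 x] by auto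
    moreover have "(1 + x) ^ 4 - 1 = 4 * x + 6 * x ^ 2 + 4 * x ^ 3 + x ^ 4"
      by (simp add: power2_eq_square power3_eq_cube power4_eq_xxxx algebra_simps)
    ultimately show ?thesis unfolding s_def x_def[symmetric] by linarith
  qed
  have two_cells: "mass n (annulus a (a * s\<^sup>2)) \<le> T / 2" if a: "0 < a" for a
  proof -
    have "mass n (annulus a (a * s\<^sup>2)) \<le> P * ((s\<^sup>2)\<^sup>2 - 1)"
      using s max by (intro mass_annulus_le[OF a]) (auto simp: P_def one_le_power)
    also have "\<dots> = P * (s ^ 4 - 1)" by simp
    also have "\<dots> \<le> P * (15 * (b / m))" using P s4 by (intro mult_left_mono) auto
    also have "\<dots> = (P * \<eta> / 6) / 2" by (simp add: \<eta>_def B_def)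
    also have "\<dots> \<le> T / 2" using T_ge by simp
    finally show ?thesis .
  qed
  obtain \<rho>0 where \<rho>0: "0 < \<rho>0" "mass n (ball 0 \<rho>0) < T / 4" using mass_small_ball[OF T] by blast
  \<comment> \<open>The first grid radius that encloses a quarter of the mass is
    \<open>a * s\<close>, where the disc of radius \<open>a\<close> holds less than a quarter. Two
    more cells from \<open>a\<close> on add at most a half, so the disc of radius
    \<open>a * s * s\<close> leaves a quarter outside, and \<open>\<rho> = a * s\<close> serves as
    the witness.\<close>
  define k where "k = (LEAST k. T / 4 \<le> mass n (ball 0 (\<rho>0 * s ^ k)))"
  have ex: "\<exists>k. T / 4 \<le> mass n (ball 0 (\<rho>0 * s ^ k))"
  proof -
    obtain R where R: "\<And>\<rho>. R \<le> \<rho> \<Longrightarrow> T / 4 \<le> mass n (ball 0 \<rho>)"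
      using mass_large_ball[of n] T unfolding T_def eventually_at_top_linorder by blast
    obtain k where "R / \<rho>0 < s ^ k" using real_arch_pow[OF s(1)] by blast
    then have "R \<le> \<rho>0 * s ^ k" using \<rho>0 by (simp add: field_simps)
    then show ?thesis using R by blast
  qed
  have k_ge: "T / 4 \<le> mass n (ball 0 (\<rho>0 * s ^ k))" unfolding k_def by (rule LeastI_ex[OF ex])
  have "k \<noteq> 0" using k_ge \<rho>0 by (intro notI) simp
  then obtain j where j: "k = Suc j" by (cases k) auto
  have "\<not> T / 4 \<le> mass n (ball 0 (\<rho>0 * s ^ j))"
    using not_less_Least[of j "\<lambda>k. T / 4 \<le> mass n (ball 0 (\<rho>0 * s ^ k))"] j by (simp add: k_def)
  moreover define a where "a = \<rho>0 * s ^ j"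
  ultimately have a: "0 < a" "mass n (ball 0 a) < T / 4" "T / 4 \<le> mass n (ball 0 (a * s))"
    using \<rho>0 s k_ge by (auto simp: j mult_ac)
  have "mass n (ball 0 (a * s * s)) = mass n (ball 0 a) + mass n (annulus a (a * s\<^sup>2))"
  proof -
    have "a * 1 \<le> a * s\<^sup>2" using a s by (intro mult_left_mono one_le_power) auto
    then have "ball 0 (a * s * s) = ball 0 a \<union> annulus a (a * s\<^sup>2)"
      by (auto simp: annulus_def power2_eq_square mult.assoc)
    moreover have "ball 0 a \<inter> annulus a (a * s\<^sup>2) = {}" by (auto simp: annulus_def)
    ultimately show ?thesis using mass_Un[of "ball 0 a" "annulus a (a * s\<^sup>2)" n] by simp
  qed
  also have "\<dots> \<le> T / 4 + T / 2" using a two_cells[of a] by simp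
  finally have "T / 4 \<le> mass n (- ball 0 (a * s * s))"
    using mass_split[of n "a * s * s"] by (simp add: T_def)
  moreover have "1 + b / 2 \<le> s ^ n"
  proof -
    \<comment> \<open>Since \<open>n \<ge> 1\<close>, the denominator \<open>m = n + 1\<close> is at
      most \<open>2 * n\<close>.\<close>
    have "b / 2 \<le> real n * (b / m)" using n b by (simp add: m_def field_simps)
    then have "1 + b / 2 \<le> 1 + real n * (b / m)" by simp
    also have "\<dots> \<le> s ^ n" unfolding s_def
      by (rule Bernoulli_inequality) (use b m in \<open>smt (verit) divide_pos_pos\<close>)
    finally show ?thesis .
  qed
  moreover have "0 < a * s" using a s by simp
  ultimately show ?thesis using n(2) s T a(3) unfolding T_def by blast
qed

section \<open>Unboundedness\<close>

abbreviation \<psi> :: "complex \<Rightarrow> real" where "\<psi> z \<equiv> \<phi> (cmod z)"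

lemma cmod_vimage_sets [measurable, simp]: "A \<in> sets borel \<Longrightarrow> cmod -` A \<in> sets borel"
  using measurable_sets[of cmod borel borel A] by simp

text \<open>The difference \<open>f - g\<close> is \<open>z ^ n\<close> times a radial function.
  Against an entire \<open>h\<close> the rotational mean leaves the conjugate of a Taylor
  coefficient times the integral of \<open>(indicator - c) * dens n\<close>, and \<open>c\<close> is
  chosen to make this integral 0.\<close>

lemma bergman_projection_cut_monomial:
  fixes A :: "real set"
  assumes A [measurable]: "A \<in> sets borel" and T: "0 < mass n UNIV"
  defines "f \<equiv> \<lambda>z. of_real (indicator A (cmod z)) * z ^ n"
    and "c \<equiv> mass n (cmod -` A) / mass n UNIV"
  shows "f \<in> L2" "bergman_projection \<psi> f = (\<lambda>z. of_real c * z ^ n)"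
proof -
  have ind: "indicat_real A (cmod z) = indicat_real (cmod -` A) z" for z by (simp add: indicator_def)
  have f_m [measurable]: "f \<in> borel_measurable borel" unfolding f_def by measurable
  have "(cmod (f z))\<^sup>2 * w z = indicator (cmod -` A) z * dens n z" for z
    by (simp add: f_def dens_def norm_mult norm_power power_mult_distrib ind indicator_def power_mult[symmetric] mult.commute)
  then show f: "f \<in> L2"
    using f_m integrable_indicator_dens[of "cmod -` A" n] by (simp add: weighted_Lp_2_iff)
  define g where "g = (\<lambda>z::complex. of_real c * z ^ n)"
  have g_hol: "g holomorphic_on UNIV" unfolding g_def by (intro holomorphic_intros)
  have "(cmod (g z))\<^sup>2 * w z = c\<^sup>2 * dens n z" for z
    by (simp add: g_def dens_def norm_mult norm_power power_mult_distrib power_mult[symmetric] mult.commute mult.left_commute)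
  then have g2: "g \<in> L2"
    using borel_measurable_continuous_onI[OF holomorphic_on_imp_continuous_on[OF g_hol]] integrable_dens[of n]
    by (simp add: weighted_Lp_2_iff)
  then have g: "g \<in> Fock" using g_hol by (simp add: fock_space_def)
  have fg: "(\<lambda>z. f z - g z) \<in> L2" using L2_diff_mult[OF f g2, of 1] by simp
  \<comment> \<open>The absolute value extends the weight continuously to negative arguments, so
    that \<open>k\<close> is Borel on the whole line.\<close>
  define k where "k r = (indicator A r - c) * exp (- 2 * \<phi> \<bar>r\<bar>)" for r :: real
  have "continuous_on UNIV (\<lambda>r. \<phi> \<bar>r\<bar>)"
    by (intro continuous_on_compose2[OF cont]) (auto intro!: continuous_intros)
  then have [measurable]: "(\<lambda>r. \<phi> \<bar>r\<bar>) \<in> borel_measurable borel" by (rule borel_measurable_continuous_onI)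
  have k_m: "k \<in> borel_measurable borel" unfolding k_def by measurable
  have "inner2 (\<lambda>z. f z - g z) h = 0" if h: "h \<in> Fock" for h
  proof -
    define G where "G z = of_real (k (cmod z)) * cnj z ^ n * h z" for z
    \<comment> \<open>The inner product conjugates \<open>h\<close>, whereas
      \<open>integral_radial_times_entire\<close> has \<open>h\<close> itself; conjugating the
      integrand brings it into that form.\<close>
    have eq: "(f z - g z) * cnj (h z) * of_real (w z) = cnj (G z)" for z
      by (simp add: f_def g_def G_def k_def algebra_simps)
    have "integrable area_measure (\<lambda>z. cnj (G z))"
      using integrable_inner2[OF fg Fock_D(2)[OF h]] by (simp only: eq)
    then have "integrable area_measure (\<lambda>z. cnj (cnj (G z)))" by (rule integrable_cnj)
    then have "(LINT z|area_measure. G z) =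
        (deriv ^^ n) h 0 / fact n * of_real (LINT z|area_measure. k (cmod z) * cmod z ^ (2 * n))"
      unfolding G_def by (intro integral_radial_times_entire[OF Fock_D(1)[OF h] k_m]) simp
    also have "(LINT z|area_measure. k (cmod z) * cmod z ^ (2 * n))
        = (LINT z|area_measure. indicator (cmod -` A) z * dens n z - c * (indicator UNIV z * dens n z))"
      by (intro Bochner_Integration.integral_cong) (auto simp: k_def dens_def ind algebra_simps)
    also have "\<dots> = mass n (cmod -` A) - c * mass n UNIV"
      unfolding mass_def using A integrable_dens[of n]
      by (subst Bochner_Integration.integral_diff) (auto simp: integrable_indicator_dens)
    also have "\<dots> = 0" using T by (simp add: c_def)
    finally have "(LINT z|area_measure. G z) = 0" by simp
    then show ?thesis unfolding weighted_inner_def eq by simp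
  qed
  then show "bergman_projection \<psi> f = (\<lambda>z. of_real c * z ^ n)"
    using bergman_projection_eqI[OF f g] by (simp add: g_def)
qed

text \<open>The projection moves a quarter of the mass from the radii in \<open>A\<close> to those in \<open>A'\<close>.\<close>

lemma bergman_bound_transfer:
  fixes A A' :: "real set"
  assumes p: "0 < p" and n: "1 \<le> n" and C: "0 < C"
    and bd: "\<And>f. f \<in> L2 \<inter> weighted_Lp p \<psi> \<Longrightarrow> bergman_projection \<psi> f \<in> weighted_Lp p \<psi> \<and>
        weighted_Lp_norm p \<psi> (bergman_projection \<psi> f) \<le> C * weighted_Lp_norm p \<psi> f"
    and A: "A \<in> sets borel" "A' \<in> sets borel" and \<alpha>: "0 < \<alpha>" and \<beta>: "0 \<le> \<beta>"
    and le: "\<And>r. r \<in> A \<Longrightarrow> 0 < r \<Longrightarrow> r powr (real n * (p - 2)) \<le> \<alpha>"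
    and ge: "\<And>r. r \<in> A' \<Longrightarrow> 0 < r \<Longrightarrow> \<alpha> * \<beta> \<le> r powr (real n * (p - 2))"
    and T: "0 < mass n UNIV"
    and mass: "mass n UNIV / 4 \<le> mass n (cmod -` A)" "mass n UNIV / 4 \<le> mass n (cmod -` A')"
  shows "\<beta> \<le> 4 * 4 powr p * C powr p"
proof -
  define f :: "complex \<Rightarrow> complex" where "f z = of_real (indicator A (cmod z)) * z ^ n" for z
  define c where "c = mass n (cmod -` A) / mass n UNIV"
  have f2: "f \<in> L2" and Pf: "bergman_projection \<psi> f = (\<lambda>z. of_real c * z ^ n)"
    using bergman_projection_cut_monomial[OF A(1) T] by (simp_all add: f_def[abs_def] c_def)
  have c: "1 / 4 \<le> c" using mass(1) T by (simp add: c_def field_simps)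
  \<comment> \<open>The Lp integrand of the monomial is its L2 density times
    \<open>|z| powr (n * (p - 2))\<close>, which is the factor compared on \<open>A\<close> and
    \<open>A'\<close>. At the origin both sides are 0 because \<open>n \<ge> 1\<close>.\<close>
  have pow: "(cmod z ^ n) powr p * w z = cmod z powr (real n * (p - 2)) * dens n z" for z
  proof (cases "z = 0")
    case False
    then have "(cmod z ^ n) powr p = cmod z powr (real n * p)"
      by (simp add: powr_realpow[symmetric] powr_powr)
    also have "real n * p = real n * (p - 2) + real (2 * n)" by (simp add: algebra_simps)
    also have "cmod z powr \<dots> = cmod z powr (real n * (p - 2)) * cmod z powr real (2 * n)"
      by (rule powr_add)
    also have "cmod z powr real (2 * n) = cmod z ^ (2 * n)"
      using False by (intro powr_realpow) simp
    finally show ?thesis by (simp add: dens_def)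
  qed (use n in \<open>simp add: dens_def\<close>)
  have f_le: "cmod (f z) powr p * w z \<le> \<alpha> * (indicator (cmod -` A) z * dens n z)" for z
  proof (cases "cmod z \<in> A \<and> z \<noteq> 0")
    case True
    then have "cmod (f z) = cmod z ^ n" by (simp add: f_def norm_power)
    then have "cmod (f z) powr p * w z = cmod z powr (real n * (p - 2)) * dens n z"
      by (simp only: pow)
    also have "\<dots> \<le> \<alpha> * dens n z" using True le by (intro mult_right_mono dens_nonneg) auto
    finally show ?thesis using True by simp
  next
    case False
    then have "f z = 0" using n by (auto simp: f_def)
    then show ?thesis using \<alpha> dens_nonneg[of n z] by simp
  qed
  have f_m [measurable]: "f \<in> borel_measurable borel" using L2_D(1)[OF f2] .
  have int_A: "integrable area_measure (\<lambda>z. \<alpha> * (indicator (cmod -` A) z * dens n z))"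
    using A by (intro integrable_mult_right integrable_indicator_dens) auto
  have int_f: "integrable area_measure (\<lambda>z. cmod (f z) powr p * w z)"
  proof (rule Bochner_Integration.integrable_bound[OF int_A])
    show "AE z in area_measure. norm (cmod (f z) powr p * w z) \<le> norm (\<alpha> * (indicator (cmod -` A) z * dens n z))"
      using f_le by (intro AE_I2) (smt (verit) exp_ge_zero powr_ge_zero real_norm_def zero_le_mult_iff)
  qed measurable
  have fp: "f \<in> weighted_Lp p \<psi>"
    using int_f f_m unfolding weighted_Lp_def by simp
  define I1 where "I1 = (LINT z|area_measure. cmod (f z) powr p * w z)"
  define I2 where "I2 = (LINT z|area_measure. cmod (of_real c * z ^ n) powr p * w z)"
  have "I1 \<le> (LINT z|area_measure. \<alpha> * (indicator (cmod -` A) z * dens n z))"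
    unfolding I1_def by (intro integral_mono int_f int_A f_le)
  also have "\<dots> = \<alpha> * mass n (cmod -` A)" by (simp add: mass_def)
  also have "\<dots> \<le> \<alpha> * mass n UNIV" using \<alpha> A by (intro mult_left_mono mass_mono) auto
  finally have I1: "I1 \<le> \<alpha> * mass n UNIV" .
  have I_nonneg: "0 \<le> I1" "0 \<le> I2"
    unfolding I1_def I2_def by (auto intro!: Bochner_Integration.integral_nonneg)
  have bound: "(\<lambda>z. of_real c * z ^ n) \<in> weighted_Lp p \<psi>" "I2 powr (1 / p) \<le> C * I1 powr (1 / p)"
    using bd[of f] f2 fp unfolding Pf by (auto simp: weighted_Lp_norm_def I1_def I2_def)
  have "I2 = (I2 powr (1 / p)) powr p" using p I_nonneg by (simp add: powr_powr)
  also have "\<dots> \<le> (C * I1 powr (1 / p)) powr p" using bound(2) p by (intro powr_mono2) auto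
  also have "\<dots> = C powr p * I1" using p C I_nonneg by (simp add: powr_mult powr_powr)
  finally have I2_le: "I2 \<le> C powr p * I1" .
  \<comment> \<open>The coefficient \<open>c \<ge> 1/4\<close> costs the factor
    \<open>(1/4) powr p\<close>. The share of mass in \<open>A'\<close> costs another 1/4, whence
    the constant \<open>4 * 4 powr p\<close>.\<close>
  have ge_pt: "(1 / 4) powr p * (\<alpha> * \<beta>) * (indicator (cmod -` A') z * dens n z) \<le> cmod (of_real c * z ^ n) powr p * w z" for z
  proof (cases "cmod z \<in> A' \<and> z \<noteq> 0")
    case True
    have "(1 / 4) powr p * ((\<alpha> * \<beta>) * dens n z) \<le> c powr p * (cmod z powr (real n * (p - 2)) * dens n z)"
      using True ge c p \<alpha> \<beta> by (intro mult_mono powr_mono2 mult_nonneg_nonneg dens_nonneg) auto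
    also have "\<dots> = cmod (of_real c * z ^ n) powr p * w z"
      using c unfolding pow[symmetric] by (simp add: norm_mult norm_power powr_mult)
    finally show ?thesis using True by simp
  next
    case False
    then have "indicator (cmod -` A') z * dens n z = 0" using n by (auto simp: dens_def)
    then have "(1 / 4) powr p * (\<alpha> * \<beta>) * (indicator (cmod -` A') z * dens n z) = 0" by (simp only: mult_zero_right)
    then show ?thesis by (rule ord_eq_le_trans) simp
  qed
  have "(1 / 4) powr p * (\<alpha> * \<beta>) * (mass n UNIV / 4) \<le> (1 / 4) powr p * (\<alpha> * \<beta>) * mass n (cmod -` A')"
    using \<alpha> \<beta> mass(2) by (intro mult_left_mono) auto
  also have "\<dots> = (LINT z|area_measure. (1 / 4) powr p * (\<alpha> * \<beta>) * (indicator (cmod -` A') z * dens n z))"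
    by (simp add: mass_def)
  \<comment> \<open>Comparing the integrals requires integrability of the larger side, which is the
    membership of the projection in \<open>weighted_Lp p \<psi>\<close>.\<close>
  also have "\<dots> \<le> I2"
    unfolding I2_def using bound(1) A unfolding weighted_Lp_def
    by (intro integral_mono ge_pt integrable_mult_right integrable_indicator_dens) auto
  also have "\<dots> \<le> C powr p * I1" by (rule I2_le)
  also have "\<dots> \<le> C powr p * (\<alpha> * mass n UNIV)" using I1 by (intro mult_left_mono) auto
  finally have "(\<alpha> * mass n UNIV) * ((1 / 4) powr p * \<beta> / 4) \<le> (\<alpha> * mass n UNIV) * C powr p"
    by (simp add: mult_ac)
  then have "(1 / 4) powr p * \<beta> / 4 \<le> C powr p" using \<alpha> T by simp
  moreover have "(1 / 4) powr p = 1 / 4 powr p" by (simp add: powr_divide)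
  ultimately show ?thesis by (simp add: field_simps)
qed

lemma bergman_bounded_imp_eq_2:
  assumes p: "0 < p" and bounded: "bergman_bounded p \<psi>"
  shows "p = 2"
proof (rule ccontr)
  assume p2: "p \<noteq> 2"
  obtain C0 where C0: "\<And>f. f \<in> L2 \<inter> weighted_Lp p \<psi> \<Longrightarrow> bergman_projection \<psi> f \<in> weighted_Lp p \<psi> \<and>
        weighted_Lp_norm p \<psi> (bergman_projection \<psi> f) \<le> C0 * weighted_Lp_norm p \<psi> f"
    using bounded unfolding bergman_bounded_def by blast
  define C where "C = max C0 1"
  have C: "0 < C" by (simp add: C_def)
  have bd: "bergman_projection \<psi> f \<in> weighted_Lp p \<psi> \<and>
        weighted_Lp_norm p \<psi> (bergman_projection \<psi> f) \<le> C * weighted_Lp_norm p \<psi> f"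
    if "f \<in> L2 \<inter> weighted_Lp p \<psi>" for f
  proof -
    have "C0 * weighted_Lp_norm p \<psi> f \<le> C * weighted_Lp_norm p \<psi> f"
      by (intro mult_right_mono) (auto simp: C_def weighted_Lp_norm_def)
    then show ?thesis using C0[OF that] by linarith
  qed
  define q where "q = \<bar>p - 2\<bar>"
  have q: "0 < q" using p2 by (simp add: q_def)
  define X where "X = 4 * 4 powr p * C powr p"
  have X: "0 < X" using C by (simp add: X_def)
  \<comment> \<open>With this choice \<open>b / 2 = X powr (1 / q)\<close>, so
    \<open>(1 + b / 2) powr q\<close> exceeds \<open>X\<close>.\<close>
  define b where "b = 2 * X powr (1 / q)"
  have b: "0 < b" using X by (simp add: b_def)
  obtain n \<rho> s where n: "1 \<le> n" and \<rho>: "0 < \<rho>" and s: "1 < s" "1 + b / 2 \<le> s ^ n"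
    and T: "0 < mass n UNIV" and inner: "mass n UNIV / 4 \<le> mass n (ball 0 \<rho>)"
    and outer: "mass n UNIV / 4 \<le> mass n (- ball 0 (\<rho> * s))"
    using mass_spread[OF b] by blast
  have \<rho>s: "0 < \<rho> * s" using \<rho> s by simp
  have vimages: "cmod -` {..<\<rho>} = ball 0 \<rho>" "cmod -` {\<rho> * s..} = - ball 0 (\<rho> * s)" by auto
  define \<beta> where "\<beta> = s powr (real n * q)"
  have "\<beta> \<le> X"
  proof (cases "2 < p")
    case True
    \<comment> \<open>For \<open>p > 2\<close> the factor \<open>r powr (n * (p - 2))\<close>
      increases with \<open>r\<close>: the source is the inner disc, with
      \<open>\<alpha> = \<rho> powr (n * q)\<close>, and the target is the outer region.\<close>
    then have qp: "p - 2 = q" by (simp add: q_def)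
    show ?thesis
      unfolding X_def
    proof (rule bergman_bound_transfer[OF p n C bd])
      show "r powr (real n * (p - 2)) \<le> \<rho> powr (real n * q)" if "r \<in> {..<\<rho>}" "0 < r" for r
        unfolding qp using that q by (intro powr_mono2) auto
      show "\<rho> powr (real n * q) * \<beta> \<le> r powr (real n * (p - 2))" if "r \<in> {\<rho> * s..}" "0 < r" for r
      proof -
        have "\<rho> powr (real n * q) * \<beta> = (\<rho> * s) powr (real n * q)"
          using \<rho> s by (simp add: \<beta>_def powr_mult)
        also have "\<dots> \<le> r powr (real n * q)" using that q \<rho>s by (intro powr_mono2) auto
        finally show ?thesis by (simp add: qp)
      qed
    qed (use \<rho> T inner outer in \<open>auto simp: vimages \<beta>_def\<close>)
  next
    case False
    \<comment> \<open>For \<open>p < 2\<close> the factor decreases, so source and target change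
      places and \<open>\<alpha>\<close> is its value at \<open>\<rho> * s\<close>. The ratio
      between the two radii is again \<open>\<beta>\<close>.\<close>
    then have qp: "p - 2 = - q" by (simp add: q_def)
    show ?thesis
      unfolding X_def
    proof (rule bergman_bound_transfer[OF p n C bd])
      show "r powr (real n * (p - 2)) \<le> (\<rho> * s) powr (- (real n * q))" if "r \<in> {\<rho> * s..}" "0 < r" for r
        unfolding qp using that q \<rho>s by (auto intro!: powr_mono2')
      show "(\<rho> * s) powr (- (real n * q)) * \<beta> \<le> r powr (real n * (p - 2))" if "r \<in> {..<\<rho>}" "0 < r" for r
      proof -
        have "(\<rho> * s) powr (- (real n * q)) * \<beta> = \<rho> powr (- (real n * q))"
          using \<rho> s by (simp add: \<beta>_def powr_mult powr_minus field_simps)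
        also have "\<dots> \<le> r powr (- (real n * q))" using that q by (intro powr_mono2') auto
        finally show ?thesis by (simp add: qp)
      qed
    qed (use \<rho>s T inner outer in \<open>auto simp: vimages \<beta>_def\<close>)
  qed
  moreover have "X < \<beta>"
  proof -
    have "X = (X powr (1 / q)) powr q" using q X by (simp add: powr_powr)
    also have "\<dots> < (1 + b / 2) powr q" using q X by (intro powr_less_mono2) (auto simp: b_def)
    also have "\<dots> \<le> (s ^ n) powr q" using s b q by (intro powr_mono2) auto
    also have "\<dots> = \<beta>" using s by (simp add: \<beta>_def powr_realpow[symmetric] powr_powr)
    finally show ?thesis .
  qed
  ultimately show False by simp
qed

end

section \<open>From derivatives on the closed half-line to the setting of
  \<open>radial_weight\<close>\<close>

lemma halfline_deriv_has_real_derivative: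
  assumes "f differentiable_on {0..}" "0 < r"
  shows "(f has_real_derivative halfline_deriv f r) (at r)"
proof -
  have "f differentiable (at r within {0..})"
    using assms by (auto simp: differentiable_on_def)
  then have "(f has_vector_derivative halfline_deriv f r) (at r within {0..})"
    unfolding halfline_deriv_def by (simp add: vector_derivative_works)
  \<comment> \<open>A positive \<open>r\<close> is interior to the half-line, so the restricted
    derivative there is the ordinary one.\<close>
  moreover have "at r within {0..} = at r"
    using assms by (intro at_within_interior) (auto simp: interior_real_atLeast)
  ultimately show ?thesis by (simp add: has_real_derivative_iff_has_vector_derivative)
qed

theorem proposition3:
  fixes \<phi> :: "real \<Rightarrow> real" and p :: real
  assumes "\<And>r. r \<ge> 0 \<Longrightarrow> \<phi> r \<ge> 0"
    and "smooth_on_halfline \<phi>"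
    and "\<And>r. r \<ge> 0 \<Longrightarrow> halfline_deriv \<phi> r > 0"
    and "filterlim \<phi> at_top at_top"
    and "filterlim (halfline_deriv \<phi>) at_top at_top"
    and "\<And>n. n \<ge> 2 \<Longrightarrow>
           ((\<lambda>r. (halfline_deriv ^^ n) \<phi> r / halfline_deriv \<phi> r ^ n) \<longlongrightarrow> 0) at_top"
    and "0 < p"
  shows "bergman_bounded p (\<lambda>z. \<phi> (cmod z)) \<longleftrightarrow> p = 2"
proof -
  have smooth: "(halfline_deriv ^^ n) \<phi> differentiable_on {0..}" for n
    using assms(2) by (simp add: smooth_on_halfline_def)
  have diff0: "\<phi> differentiable_on {0..}" using smooth[of 0] by simp
  have diff1: "halfline_deriv \<phi> differentiable_on {0..}" using smooth[of 1] by simp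
  interpret radial_weight \<phi> "halfline_deriv \<phi>" "halfline_deriv (halfline_deriv \<phi>)"
  proof
    show "((\<lambda>r. halfline_deriv (halfline_deriv \<phi>) r / halfline_deriv \<phi> r ^ 2) \<longlongrightarrow> 0) at_top"
      using assms(6)[of 2] by (simp add: numeral_2_eq_2)
  qed (use assms diff0 diff1 in \<open>auto intro: differentiable_imp_continuous_on halfline_deriv_has_real_derivative\<close>)
  show ?thesis
    using bergman_bounded_2 bergman_bounded_imp_eq_2[OF assms(7)] by auto
qed

end
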